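(* The decision problem $\textsc{trSat}[\mathcal{T}^{\textsc{log}}_{\mathit{udec}}]$ is undecidable.
   Context: A transformer encoder (TE) $T$ over a finite alphabet $\Sigma$ with $L$ layers and $h_i$ attention heads in layer $i$ consists of: a positional embedding $\mathit{emb}\colon\Sigma\times\mathbb{N}\to\mathbb{R}^{d_0}$; for each $1\le i\le L$, $1\le j\le h_i$ an attention head $(\mathit{score}_{i,j},\mathit{pool}_{i,j})$ with scoring function $\mathit{score}_{i,j}\colon\mathbb{R}^{d_{i-1}}\times\mathbb{R}^{d_{i-1}}\to\mathbb{R}$ and pooling function $\mathit{pool}_{i,j}(\boldsymbol{x}_1,\dots,\boldsymbol{x}_n,s_1,\dots,s_n)=\sum_{i'=1}^n \mathit{norm}_{i,j}(i',s_1,\dots,s_n)\,W_{i,j}\boldsymbol{x}_{i'}$, where $W_{i,j}$ is a matrix and $\mathit{norm}_{i,j}$ a normalisation function; combination functions $\mathit{comb}_i$; and an output function $\mathit{out}\colon\mathbb{R}^{d_L}\to\mathbb{R}$. On input $w=a_1\cdots a_n\in\Sigma^+$: $\boldsymbol{x}^0_m=\mathit{emb}(a_m,m)$; $\boldsymbol{y}^i_{m,j}=\mathit{pool}_{i,j}(\boldsymbol{x}^{i-1}_1,\dots,\boldsymbol{x}^{i-1}_n,\mathit{score}_{i,j}(\boldsymbol{x}^{i-1}_m,\boldsymbol{x}^{i-1}_1),\dots,\mathit{score}_{i,j}(\boldsymbol{x}^{i-1}_m,\boldsymbol{x}^{i-1}_n))$, $\boldsymbol{x}^i_m=\mathit{comb}_i(\boldsymbol{x}^{i-1}_m,\boldsymbol{y}^i_{m,1},\dots,\boldsymbol{y}^i_{m,h_i})$;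 $T(w)=\mathit{out}(\boldsymbol{x}^L_n)$. For a class $\mathcal{C}$ of TE, $\textsc{trSat}[\mathcal{C}]$ is: given $T\in\mathcal{C}$ over $\Sigma$, decide whether some $w\in\Sigma^+$ has $T(w)=1$. $\mathrm{hardmax}(i,x_1,\dots,x_n)=\frac1m$ if $x_i\ge x_j$ for all $j$, where $m$ is the number of $j$ with $x_j=x_i$, and $0$ otherwise. $\mathcal{T}_{\mathit{udec}}$ is the class of TE with these components allowed: positional embeddings $\mathit{emb}(a_k,0)=(1,1,0,0,k)$, $\mathit{emb}(a_k,i)=(0,1,i,\sum_{j=0}^{i}j,k)$ for $i\ge1$ (fixed enumeration $a_1,a_2,\dots$ of the alphabet); scoring functions $(\boldsymbol{x},\boldsymbol{y})\mapsto N(\langle Q\boldsymbol{x},K\boldsymbol{y}\rangle)$ with linear maps $Q,K$ and a ReLU feed-forward neural network $N$; normalisation $\mathrm{hardmax}$; combination and output functions given by ReLU feed-forward neural networks. A fixed-width arithmetic (e.g. fixed- or floating-point) represents numbers in binary with a fixed number of bits $b$ (so at most $2^b$ representable rationals), handling overflow by saturation or wrap-around and rounding up or off; a TE works over it if all values and computations are carried out in it. $\mathcal{T}^{\textsc{log}}_{\mathit{udec}}$ is defined exactly as $\mathcal{T}_{\mathit{udec}}$, except that for every $T\in\mathcal{T}^{\textsc{log}}_{\mathit{udec}}$ over alphabet $\Sigma$ and every word $w$ with $|w|=n$, the computation of $T(w)$ is carried out in some fixed-width arithmetic using $\mathcal{O}(\log(\max(|\Sigma|,n)))$ bits. *)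

theory Defs
  imports Complex_Main "HOL-Library.Nat_Bijection" "HOL-Library.Log_Nat"
begin

section \<open>Transformer encoders\<close>

text \<open>
  Letters are given by their index in the fixed enumeration \<open>a\<^sub>1, a\<^sub>2, \<dots>\<close> of the alphabet.
  Numbers are rational, because every value of a fixed-width arithmetic is.
\<close>

type_synonym vec = "rat list"

record attention_head =
  score :: "vec \<Rightarrow> vec \<Rightarrow> rat"
  pool :: "vec list \<Rightarrow> rat list \<Rightarrow> vec"

record encoder_layer =
  heads :: "attention_head list"
  comb :: "vec \<Rightarrow> vec list \<Rightarrow> vec"

record encoder =
  emb :: "nat \<Rightarrow> nat \<Rightarrow> vec"
  layers :: "encoder_layer list"
  out :: "vec \<Rightarrow> rat"

definition head_value :: "attention_head \<Rightarrow> vec list \<Rightarrow> vec \<Rightarrow> vec" where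
  "head_value h xs x = pool h xs (map (score h x) xs)"

definition layer_step :: "encoder_layer \<Rightarrow> vec list \<Rightarrow> vec list" where
  "layer_step l xs = map (\<lambda>x. comb l x (map (\<lambda>h. head_value h xs x) (heads l))) xs"

definition initial_vectors :: "encoder \<Rightarrow> nat list \<Rightarrow> vec list" where
  "initial_vectors T w = map (\<lambda>m. emb T (w ! (m - 1)) m) [1..<length w + 1]"

definition run_encoder :: "encoder \<Rightarrow> nat list \<Rightarrow> rat" where
  "run_encoder T w = out T (last (fold layer_step (layers T) (initial_vectors T w)))"

text \<open>The index is zero-based.\<close>

definition hardmax :: "nat \<Rightarrow> rat list \<Rightarrow> rat" where
  "hardmax i s =
     (if \<forall>j<length s. s ! j \<le> s ! i then 1 / of_nat (card {j. j < length s \<and> s ! j = s ! i}) else 0)"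


section \<open>Fixed-width arithmetics\<close>

datatype fwa_kind = Fixed_Point | Floating_Point
datatype overflow = Saturate | Wrap
datatype rounding = Round_Up | Round_Down | Round_Nearest

text \<open>
  With widths \<open>p\<close> and \<open>q\<close>, a number occupies \<open>p + q\<close> bits. Fixed point: a two's complement
  number with \<open>p\<close> integer bits (including the sign) and \<open>q\<close> fractional bits. Floating point:
  \<open>m * 2\<^sup>e\<close> with a two's complement significand \<open>m\<close> of \<open>p\<close> bits and a two's complement
  exponent \<open>e\<close> of \<open>q\<close> bits.
\<close>

fun fwa_values :: "fwa_kind \<Rightarrow> nat \<Rightarrow> nat \<Rightarrow> rat set" where
  "fwa_values Fixed_Point p q = {of_int m / 2 ^ q |m. - (2 ^ (p + q - 1)) \<le> m \<and> m < 2 ^ (p + q - 1)}"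
| "fwa_values Floating_Point p q =
     {of_int m * 2 powi e |m e. - (2 ^ (p - 1)) \<le> m \<and> m < 2 ^ (p - 1) \<and>
                                - (2 ^ (q - 1)) \<le> e \<and> e < 2 ^ (q - 1)}"

text \<open>
  Wrap-around takes place modulo \<open>2\<^sup>p\<close> units of the coarsest grid, that is, modulo the distance
  between the smallest value and the first grid point above the largest value.
\<close>

fun fwa_period :: "fwa_kind \<Rightarrow> nat \<Rightarrow> nat \<Rightarrow> rat" where
  "fwa_period Fixed_Point p q = 2 ^ p"
| "fwa_period Floating_Point p q = 2 ^ p * 2 powi (2 ^ (q - 1) - 1)"

text \<open>Used only for \<open>Min V \<le> r \<le> Max V\<close>.\<close>

definition round_within :: "rounding \<Rightarrow> rat set \<Rightarrow> rat \<Rightarrow> rat" where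
  "round_within \<rho> V r =
     (let u = Min {x \<in> V. r \<le> x}; d = Max {x \<in> V. x \<le> r} in
      case \<rho> of
        Round_Up \<Rightarrow> u
      | Round_Down \<Rightarrow> d
      | Round_Nearest \<Rightarrow> (if u - r \<le> r - d then u else d))"

definition fwa_round :: "fwa_kind \<Rightarrow> nat \<Rightarrow> nat \<Rightarrow> overflow \<Rightarrow> rounding \<Rightarrow> rat \<Rightarrow> rat" where
  "fwa_round k p q ov \<rho> r =
     (let V = fwa_values k p q; lo = Min V; P = fwa_period k p q in
      case ov of
        Saturate \<Rightarrow> round_within \<rho> V (max lo (min (Max V) r))
      | Wrap \<Rightarrow>
          (let y = round_within \<rho> (insert (lo + P) V) (r - P * of_int \<lfloor>(r - lo) / P\<rfloor>)
           in if y = lo + P then lo else y))"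

text \<open>
  An arithmetic whose widths grow with \<open>N = max |\<Sigma>| n\<close>. Each width is given by two coefficients
  \<open>(a, b)\<close> and equals \<open>a * floorlog 2 N + b\<close>, where \<open>floorlog 2 N\<close> is the length of \<open>N\<close> in
  binary. Fixing the shape of the dependency on \<open>N\<close> makes the arithmetic part of a finite problem
  instance, and it leaves no room for hiding a computation in the choice of the widths.
\<close>

record fwa_scheme =
  kind :: fwa_kind
  overflow_mode :: overflow
  rounding_mode :: rounding
  width1 :: "nat \<times> nat"
  width2 :: "nat \<times> nat"

definition width_at :: "nat \<times> nat \<Rightarrow> nat \<Rightarrow> nat" where
  "width_at c N = fst c * floorlog 2 N + snd c"

definition scheme_bits :: "fwa_scheme \<Rightarrow> nat \<Rightarrow> nat" where
  "scheme_bits A N = width_at (width1 A) N + width_at (width2 A) N"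

definition scheme_round :: "fwa_scheme \<Rightarrow> nat \<Rightarrow> rat \<Rightarrow> rat" where
  "scheme_round A N =
     fwa_round (kind A) (width_at (width1 A) N) (width_at (width2 A) N)
       (overflow_mode A) (rounding_mode A)"

definition scheme_wf :: "fwa_scheme \<Rightarrow> bool" where
  "scheme_wf A \<longleftrightarrow>
     (\<forall>N\<ge>1. 1 \<le> width_at (width1 A) N \<and> (kind A = Floating_Point \<longrightarrow> 1 \<le> width_at (width2 A) N))"


section \<open>Computations carried out in an arithmetic\<close>

text \<open>
  \<open>rnd\<close> maps a rational to the value representing it; every constant and the result of every
  elementary operation is rounded, and sums are evaluated from left to right. With \<open>rnd = id\<close>
  the computations are exact.
\<close>

definition sum_in :: "(rat \<Rightarrow> rat) \<Rightarrow> rat list \<Rightarrow> rat" where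
  "sum_in rnd xs = foldl (\<lambda>s x. rnd (s + x)) 0 xs"

definition inner_in :: "(rat \<Rightarrow> rat) \<Rightarrow> vec \<Rightarrow> vec \<Rightarrow> rat" where
  "inner_in rnd u v = sum_in rnd (map2 (\<lambda>a b. rnd (a * b)) u v)"

text \<open>A matrix is the list of its rows.\<close>

type_synonym matrix = "rat list list"

definition matrix_dims :: "nat \<Rightarrow> nat \<Rightarrow> matrix \<Rightarrow> bool" where
  "matrix_dims r c M \<longleftrightarrow> length M = r \<and> (\<forall>row \<in> set M. length row = c)"

definition apply_matrix :: "(rat \<Rightarrow> rat) \<Rightarrow> matrix \<Rightarrow> vec \<Rightarrow> vec" where
  "apply_matrix rnd M x = map (\<lambda>row. inner_in rnd (map rnd row) x) M"

text \<open>
  A network is the list of its layers, a layer is a list of neurons, and a neuron consists of its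
  input weights and its bias. Hidden layers use ReLU, the output layer is affine.
\<close>

type_synonym fnn_layer = "(rat list \<times> rat) list"
type_synonym fnn = "fnn_layer list"

definition apply_affine :: "(rat \<Rightarrow> rat) \<Rightarrow> fnn_layer \<Rightarrow> vec \<Rightarrow> vec" where
  "apply_affine rnd l x = map (\<lambda>(w, b). rnd (inner_in rnd (map rnd w) x + rnd b)) l"

definition relu :: "rat \<Rightarrow> rat" where
  "relu x = max 0 x"

fun apply_fnn :: "(rat \<Rightarrow> rat) \<Rightarrow> fnn \<Rightarrow> vec \<Rightarrow> vec" where
  "apply_fnn rnd [] x = x"
| "apply_fnn rnd [l] x = apply_affine rnd l x"
| "apply_fnn rnd (l # l' # ls) x = apply_fnn rnd (l' # ls) (map relu (apply_affine rnd l x))"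

fun fnn_dims :: "nat \<Rightarrow> fnn \<Rightarrow> nat \<Rightarrow> bool" where
  "fnn_dims d [] e \<longleftrightarrow> d = e"
| "fnn_dims d (l # ls) e \<longleftrightarrow> (\<forall>(w, b) \<in> set l. length w = d) \<and> fnn_dims (length l) ls e"

definition is_fnn :: "nat \<Rightarrow> fnn \<Rightarrow> nat \<Rightarrow> bool" where
  "is_fnn d N e \<longleftrightarrow> N \<noteq> [] \<and> fnn_dims d N e"


section \<open>The class of encoders\<close>

record head_desc =
  query_matrix :: matrix
  key_matrix :: matrix
  score_net :: fnn
  value_matrix :: matrix

record layer_desc =
  head_descs :: "head_desc list"
  comb_net :: fnn

record encoder_desc =
  alphabet_size :: nat
  layer_descs :: "layer_desc list"
  out_net :: fnn

definition head_wf :: "nat \<Rightarrow> head_desc \<Rightarrow> bool" where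
  "head_wf d h \<longleftrightarrow>
     (\<exists>r. matrix_dims r d (query_matrix h) \<and> matrix_dims r d (key_matrix h)) \<and>
     is_fnn 1 (score_net h) 1 \<and>
     (\<exists>r. matrix_dims r d (value_matrix h))"

text \<open>The combination network reads the concatenation of the old vector and of the head values.\<close>

definition layer_wf :: "nat \<Rightarrow> layer_desc \<Rightarrow> nat \<Rightarrow> bool" where
  "layer_wf d l e \<longleftrightarrow>
     (\<forall>h \<in> set (head_descs l). head_wf d h) \<and>
     is_fnn (d + (\<Sum>h\<leftarrow>head_descs l. length (value_matrix h))) (comb_net l) e"

fun layers_wf :: "nat \<Rightarrow> layer_desc list \<Rightarrow> nat \<Rightarrow> bool" where
  "layers_wf d [] e \<longleftrightarrow> d = e"
| "layers_wf d (l # ls) e \<longleftrightarrow> (\<exists>d'. layer_wf d l d' \<and> layers_wf d' ls e)"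

definition TE_udec :: "encoder_desc set" where
  "TE_udec =
     {T. 1 \<le> alphabet_size T \<and> (\<exists>d. layers_wf 5 (layer_descs T) d \<and> is_fnn d (out_net T) 1)}"

definition emb_udec :: "nat \<Rightarrow> nat \<Rightarrow> vec" where
  "emb_udec k i =
     (if i = 0 then [1, 1, 0, 0, of_nat k] else [0, 1, of_nat i, of_nat (\<Sum>j=0..i. j), of_nat k])"

definition score_in :: "(rat \<Rightarrow> rat) \<Rightarrow> head_desc \<Rightarrow> vec \<Rightarrow> vec \<Rightarrow> rat" where
  "score_in rnd h x y =
     hd (apply_fnn rnd (score_net h)
       [inner_in rnd (apply_matrix rnd (query_matrix h) x) (apply_matrix rnd (key_matrix h) y)])"

definition pool_in :: "(rat \<Rightarrow> rat) \<Rightarrow> head_desc \<Rightarrow> vec list \<Rightarrow> rat list \<Rightarrow> vec" where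
  "pool_in rnd h xs s =
     foldl (map2 (\<lambda>a b. rnd (a + b))) (replicate (length (value_matrix h)) 0)
       (map (\<lambda>i. map (\<lambda>y. rnd (rnd (hardmax i s) * y)) (apply_matrix rnd (value_matrix h) (xs ! i)))
         [0..<length xs])"

definition head_in :: "(rat \<Rightarrow> rat) \<Rightarrow> head_desc \<Rightarrow> attention_head" where
  "head_in rnd h = \<lparr>score = score_in rnd h, pool = pool_in rnd h\<rparr>"

definition layer_in :: "(rat \<Rightarrow> rat) \<Rightarrow> layer_desc \<Rightarrow> encoder_layer" where
  "layer_in rnd l =
     \<lparr>heads = map (head_in rnd) (head_descs l),
      comb = (\<lambda>x ys. apply_fnn rnd (comb_net l) (x @ concat ys))\<rparr>"

definition encoder_in :: "(rat \<Rightarrow> rat) \<Rightarrow> encoder_desc \<Rightarrow> encoder" where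
  "encoder_in rnd T =
     \<lparr>emb = (\<lambda>k i. map rnd (emb_udec k i)),
      layers = map (layer_in rnd) (layer_descs T),
      out = (\<lambda>x. hd (apply_fnn rnd (out_net T) x))\<rparr>"

text \<open>
  \<open>c\<close> is the constant of the O-notation; it is the same for all encoders of the class. The bound
  is not imposed for \<open>max |\<Sigma>| n = 1\<close>, where the logarithm vanishes.
\<close>

definition TE_udec_log :: "nat \<Rightarrow> (encoder_desc \<times> fwa_scheme) set" where
  "TE_udec_log c =
     {(T, A). T \<in> TE_udec \<and> scheme_wf A \<and>
        (\<forall>n\<ge>1. let N = max (alphabet_size T) n in
           2 \<le> N \<longrightarrow> real (scheme_bits A N) \<le> real c * log 2 (real N))}"

definition run_log :: "encoder_desc \<times> fwa_scheme \<Rightarrow> nat list \<Rightarrow> rat" where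
  "run_log I w =
     (case I of (T, A) \<Rightarrow>
        run_encoder (encoder_in (scheme_round A (max (alphabet_size T) (length w))) T) w)"

definition satisfiable_log :: "encoder_desc \<times> fwa_scheme \<Rightarrow> bool" where
  "satisfiable_log I \<longleftrightarrow> (\<exists>w. w \<noteq> [] \<and> set w \<subseteq> {1..alphabet_size (fst I)} \<and> run_log I w = 1)"


section \<open>Decidability\<close>

text \<open>Partial recursive functions, by their graphs.\<close>

datatype recf =
    Zero
  | Succ
  | Proj nat
  | Comp recf "recf list"
  | Prim_Rec recf recf
  | Mu recf

inductive computes :: "recf \<Rightarrow> nat list \<Rightarrow> nat \<Rightarrow> bool" where
  zero: "computes Zero xs 0"
| succ: "computes Succ [x] (Suc x)"
| proj: "i < length xs \<Longrightarrow> computes (Proj i) xs (xs ! i)"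
| comp: "list_all2 (\<lambda>g y. computes g xs y) gs ys \<Longrightarrow> computes f ys z \<Longrightarrow> computes (Comp f gs) xs z"
| prim_rec_0: "computes f xs y \<Longrightarrow> computes (Prim_Rec f g) (0 # xs) y"
| prim_rec_Suc: "computes (Prim_Rec f g) (n # xs) r \<Longrightarrow> computes g (n # r # xs) y \<Longrightarrow>
    computes (Prim_Rec f g) (Suc n # xs) y"
| mu: "computes f (n # xs) 0 \<Longrightarrow> \<forall>m<n. \<exists>y. computes f (m # xs) (Suc y) \<Longrightarrow> computes (Mu f) xs n"

text \<open>
  The problem: given (the code of) an instance in \<open>C\<close>, decide whether it satisfies \<open>P\<close>.
  The behaviour of the decision procedure on other inputs is irrelevant.
\<close>

definition decidable_problem :: "('a \<Rightarrow> nat) \<Rightarrow> 'a set \<Rightarrow> ('a \<Rightarrow> bool) \<Rightarrow> bool" where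
  "decidable_problem code C P \<longleftrightarrow>
     (\<exists>f. \<forall>x \<in> C. computes f [code x] (if P x then 1 else 0))"

definition code_rat :: "rat \<Rightarrow> nat" where
  "code_rat r = (case quotient_of r of (a, b) \<Rightarrow> prod_encode (int_encode a, int_encode b))"

definition code_list :: "('a \<Rightarrow> nat) \<Rightarrow> 'a list \<Rightarrow> nat" where
  "code_list code xs = list_encode (map code xs)"

definition code_matrix :: "matrix \<Rightarrow> nat" where
  "code_matrix = code_list (code_list code_rat)"

definition code_fnn :: "fnn \<Rightarrow> nat" where
  "code_fnn = code_list (code_list (\<lambda>(w, b). prod_encode (code_list code_rat w, code_rat b)))"

definition code_head :: "head_desc \<Rightarrow> nat" where
  "code_head h =
     list_encode [code_matrix (query_matrix h), code_matrix (key_matrix h),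
                  code_fnn (score_net h), code_matrix (value_matrix h)]"

definition code_layer :: "layer_desc \<Rightarrow> nat" where
  "code_layer l = prod_encode (code_list code_head (head_descs l), code_fnn (comb_net l))"

definition code_encoder :: "encoder_desc \<Rightarrow> nat" where
  "code_encoder T =
     list_encode [alphabet_size T, code_list code_layer (layer_descs T), code_fnn (out_net T)]"

definition code_scheme :: "fwa_scheme \<Rightarrow> nat" where
  "code_scheme A =
     list_encode
       [case kind A of Fixed_Point \<Rightarrow> 0 | Floating_Point \<Rightarrow> 1,
        case overflow_mode A of Saturate \<Rightarrow> 0 | Wrap \<Rightarrow> 1,
        case rounding_mode A of Round_Up \<Rightarrow> 0 | Round_Down \<Rightarrow> 1 | Round_Nearest \<Rightarrow> 2,
        prod_encode (width1 A), prod_encode (width2 A)]"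

definition code_instance :: "encoder_desc \<times> fwa_scheme \<Rightarrow> nat" where
  "code_instance I = prod_encode (code_encoder (fst I), code_scheme (snd I))"

lemma inj_code_rat: "inj code_rat"
  by (rule injI)
     (auto simp: code_rat_def inj_eq[OF inj_int_encode] intro: quotient_of_inject split: prod.splits)

lemma inj_code_list: "inj code \<Longrightarrow> inj (code_list code)"
  by (rule injI) (auto simp: code_list_def inj_eq[OF inj_list_encode] inj_map_eq_map)

lemma inj_code_matrix: "inj code_matrix"
  by (simp add: code_matrix_def inj_code_list inj_code_rat)

lemma inj_code_fnn: "inj code_fnn"
  unfolding code_fnn_def
  by (intro inj_code_list)
     (auto intro!: injI simp: inj_eq[OF inj_code_rat] inj_eq[OF inj_code_list[OF inj_code_rat]])

lemma inj_code_head: "inj code_head"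
  by (rule injI)
     (auto simp: code_head_def inj_eq[OF inj_code_matrix] inj_eq[OF inj_code_fnn]
           intro: head_desc.equality)

lemma inj_code_layer: "inj code_layer"
  by (rule injI)
     (auto simp: code_layer_def inj_eq[OF inj_code_list[OF inj_code_head]] inj_eq[OF inj_code_fnn]
           intro: layer_desc.equality)

lemma inj_code_encoder: "inj code_encoder"
  by (rule injI)
     (auto simp: code_encoder_def inj_eq[OF inj_code_list[OF inj_code_layer]]
             inj_eq[OF inj_code_fnn]
           intro: encoder_desc.equality)

lemma inj_code_scheme: "inj code_scheme"
  by (rule injI)
     (auto simp: code_scheme_def intro!: fwa_scheme.equality
           split: fwa_kind.splits overflow.splits rounding.splits)

lemma inj_code_instance: "inj code_instance"
  by (rule injI)
     (auto simp: code_instance_def prod_eq_iff inj_eq[OF inj_code_encoder]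
             inj_eq[OF inj_code_scheme])

end

theory Submission
  imports Defs
begin

text \<open>
  A word is read as a run of a counter machine, one instruction per letter. In the fixed-point
  arithmetic without fractional bits that rounds up, every hardmax weight becomes \<open>0\<close> or \<open>1\<close>, so
  attention restricted to the positions up to the current one computes the exact values of the
  counters there. The next layer turns every illegal instruction into a positive number, and a last
  attention head adds these numbers up. All values are polynomial in the word length and the size of
  the alphabet, hence logarithmically many bits suffice.

  Every partial recursive function is computed by such a machine, which guesses its input; the
  output network compares the guess with a constant \<open>x\<close>. Suppose that \<open>f\<close> decides satisfiability, and
  take the machine that applies \<open>f\<close> to the code of the instance whose layers have code \<open>x\<close> and whose
  output network has constant \<open>x\<close>, and accepts if the result is \<open>0\<close>. With \<open>x\<close> the code of the layers
  built from this very machine, the instance is satisfiable if and only if \<open>f\<close> says that it is not.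
\<close>

section \<open>Counter programs for partial recursive functions\<close>

text \<open>The number of bits depends on \<open>max |\<Sigma>| n\<close>, yet the weights built
  from an arbitrary \<open>f\<close>, and the constant \<open>x\<close>, have to be exact on short
  words as well. The alphabet pays for them: it has \<open>Suc x\<close> letters, and those beyond
  \<open>K\<close> change no counter. Since \<open>x\<close> is a code of the layers, it is at least
  \<open>K + 3\<close>, which bounds all their weights, biases and row lengths. So a single number
  \<open>M = max |\<Sigma>| n\<close> bounds everything that enters the computation, every value
  stays below a fixed power of \<open>M\<close>, and exactness becomes an addition of exponents.

  Satisfiability asks for some word, so nondeterminism costs nothing, and a diverging computation is
  simply one without a complete run. Counter programs are therefore relations, and their loops guess
  the number of iterations.

  No recursion theorem is needed: \<open>x\<close> enters an instance only through the alphabet size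
  and one bias of the output network. The layers are thus fixed before \<open>x\<close> is chosen,
  and \<open>x\<close> may then be their own code.\<close>

lemma list_all2_functional:
  assumes "list_all2 (\<lambda>g y. P g y \<and> (\<forall>z. P g z \<longrightarrow> z = y)) gs ys" "list_all2 P gs zs"
  shows "zs = ys"
  using assms by (induction gs arbitrary: ys zs) (auto simp: list_all2_Cons1)

lemma computes_Zero_iff: "computes Zero xs y \<longleftrightarrow> y = 0"
  by (subst computes.simps) auto

lemma computes_Succ_iff: "computes Succ xs y \<longleftrightarrow> (\<exists>x. xs = [x] \<and> y = Suc x)"
  by (subst computes.simps) auto

lemma computes_Proj_iff: "computes (Proj i) xs y \<longleftrightarrow> i < length xs \<and> y = xs ! i"
  by (subst computes.simps) auto

lemma computes_Comp_iff:
  "computes (Comp f gs) xs z \<longleftrightarrow> (\<exists>ys. list_all2 (\<lambda>g y. computes g xs y) gs ys \<and> computes f ys z)"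
  by (subst computes.simps) auto

lemma computes_Prim_Rec_0_iff: "computes (Prim_Rec f g) (0 # xs) y \<longleftrightarrow> computes f xs y"
  by (subst computes.simps) auto

lemma computes_Prim_Rec_Suc_iff:
  "computes (Prim_Rec f g) (Suc n # xs) y \<longleftrightarrow>
     (\<exists>r. computes (Prim_Rec f g) (n # xs) r \<and> computes g (n # r # xs) y)"
  by (subst computes.simps) auto

lemma computes_Prim_Rec_Nil: "\<not> computes (Prim_Rec f g) [] y"
  by (subst computes.simps) auto

lemma computes_Mu_iff:
  "computes (Mu f) xs n \<longleftrightarrow>
     computes f (n # xs) 0 \<and> (\<forall>m<n. \<exists>y. computes f (m # xs) (Suc y))"
  by (subst computes.simps) auto

lemmas computes_iffs = computes_Zero_iff computes_Succ_iff computes_Proj_iff computes_Comp_iff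
  computes_Prim_Rec_0_iff computes_Prim_Rec_Suc_iff computes_Prim_Rec_Nil computes_Mu_iff

text \<open>This finally rules out that one computation yields both 0 and 1. In the
  \<open>Mu\<close> case, the smaller of two results would be a zero where the other one demands a
  positive value.\<close>

lemma computes_functional:
  assumes "computes f xs y" "computes f xs z"
  shows "z = y"
  using assms
proof (induction arbitrary: z)
  case (comp xs gs ys f y)
  from comp.prems obtain zs where zs: "list_all2 (\<lambda>g z. computes g xs z) gs zs" "computes f zs z"
    by (auto simp: computes_Comp_iff)
  have "zs = ys"
    by (rule list_all2_functional[OF _ zs(1)]) (rule list_all2_mono[OF comp.IH(1)], blast)
  with zs comp.IH(2) show ?case by blast
next
  case (prim_rec_Suc f g n xs r y)
  then show ?case by (metis computes_Prim_Rec_Suc_iff)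
next
  case (mu f n xs)
  from mu.prems have z: "computes f (z # xs) 0" "\<forall>m<z. \<exists>y. computes f (m # xs) (Suc y)"
    by (auto simp: computes_Mu_iff)
  have "\<not> z < n" using mu.IH(2) z(1) by blast
  moreover have "\<not> n < z" using mu.IH(1) z(2) by blast
  ultimately show ?case by simp
qed (auto simp: computes_Zero_iff computes_Succ_iff computes_Proj_iff computes_Prim_Rec_0_iff)

section \<open>Nondeterministic counter programs and their relational semantics\<close>

datatype action = Inc nat | Dec nat | Test nat | Nop

fun act :: "action \<Rightarrow> (nat \<Rightarrow> nat) \<Rightarrow> (nat \<Rightarrow> nat) \<Rightarrow> bool" where
  "act (Inc j) s s' \<longleftrightarrow> s' = s(j := Suc (s j))"
| "act (Dec j) s s' \<longleftrightarrow> 0 < s j \<and> s' = s(j := s j - 1)"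
| "act (Test j) s s' \<longleftrightarrow> s j = 0 \<and> s' = s"
| "act Nop s s' \<longleftrightarrow> s' = s"

datatype program = Act action | Seq program program | Star program

fun exec :: "program \<Rightarrow> (nat \<Rightarrow> nat) \<Rightarrow> (nat \<Rightarrow> nat) \<Rightarrow> bool" where
  "exec (Act a) = act a"
| "exec (Seq p q) = exec p OO exec q"
| "exec (Star p) = (exec p)\<^sup>*\<^sup>*"

text \<open>\<open>\<sigma> i y\<close> is the state after \<open>i\<close> rounds, \<open>y\<close>
  the data computed so far, and \<open>P i y\<close> says that \<open>y\<close> can arise after
  \<open>i\<close> rounds. The initial \<open>y\<close> is existential because going back along
  \<open>chain\<close> ends at some pair \<open>P 0 y\<close>, not at a prescribed one.\<close>

lemma exec_Star_iff:
  assumes step: "\<And>i y s'. P i y \<Longrightarrow> exec p (\<sigma> i y) s' \<longleftrightarrow> (\<exists>y'. Q i y y' \<and> s' = \<sigma> (Suc i) y')"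
    and chain: "\<And>i y'. P (Suc i) y' \<longleftrightarrow> (\<exists>y. P i y \<and> Q i y y')"
  shows "(\<exists>y. P 0 y \<and> exec (Star p) (\<sigma> 0 y) s') \<longleftrightarrow> (\<exists>i y. P i y \<and> s' = \<sigma> i y)"
proof
  assume "\<exists>y. P 0 y \<and> exec (Star p) (\<sigma> 0 y) s'"
  then obtain y where y: "P 0 y" and "(exec p)\<^sup>*\<^sup>* (\<sigma> 0 y) s'" by auto
  from this(2) show "\<exists>i y. P i y \<and> s' = \<sigma> i y"
  proof induction
    case base
    show ?case using y by blast
  next
    case (step t u)
    then obtain i y where "P i y" "t = \<sigma> i y" by blast
    with step.hyps(2) chain assms(1) show ?case by blast
  qed
next
  assume "\<exists>i y. P i y \<and> s' = \<sigma> i y"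
  then obtain i y where "P i y" "s' = \<sigma> i y" by blast
  then show "\<exists>y. P 0 y \<and> exec (Star p) (\<sigma> 0 y) s'"
  proof (induction i arbitrary: y s')
    case (Suc i)
    then obtain z where z: "P i z" "Q i z y" using chain by blast
    with Suc.IH obtain y0 where "P 0 y0" "exec (Star p) (\<sigma> 0 y0) (\<sigma> i z)" by blast
    moreover have "exec p (\<sigma> i z) s'" using z Suc.prems step by blast
    ultimately show ?case by auto
  qed auto
qed

lemma exec_Star_count:
  assumes step: "\<And>i s'. P i \<Longrightarrow> exec p (\<sigma> i) s' \<longleftrightarrow> P (Suc i) \<and> s' = \<sigma> (Suc i)"
    and down: "\<And>i. P (Suc i) \<Longrightarrow> P i" and "P 0"
  shows "exec (Star p) (\<sigma> 0) s' \<longleftrightarrow> (\<exists>i. P i \<and> s' = \<sigma> i)"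
  using exec_Star_iff[where P = "\<lambda>i (_::unit). P i" and p = p and \<sigma> = "\<lambda>i _. \<sigma> i"
      and Q = "\<lambda>i _ _. P (Suc i)" and s' = s'] assms by auto

text \<open>\<open>Star\<close> may stop after any number of rounds; the test behind it discards the
  runs that stopped too early. All loops below are controlled in this way.\<close>

definition reset :: "nat \<Rightarrow> program" where
  "reset d = Seq (Star (Act (Dec d))) (Act (Test d))"

lemma exec_reset: "exec (reset d) s s' \<longleftrightarrow> s' = s(d := 0)"
proof -
  have "exec (Star (Act (Dec d))) (s(d := s d - 0)) t \<longleftrightarrow> (\<exists>i. i \<le> s d \<and> t = s(d := s d - i))" for t
    by (rule exec_Star_count) auto
  then show ?thesis by (auto simp: reset_def relcompp_apply simp del: exec.simps(3))
qed

definition copy :: "nat \<Rightarrow> nat \<Rightarrow> nat \<Rightarrow> program" where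
  "copy r d t =
     Seq (reset d)
      (Seq (Seq (Star (Seq (Act (Dec r)) (Seq (Act (Inc d)) (Act (Inc t))))) (Act (Test r)))
        (Seq (Star (Seq (Act (Dec t)) (Act (Inc r)))) (Act (Test t))))"

lemma exec_copy:
  assumes "s t = 0" "distinct [r, d, t]"
  shows "exec (copy r d t) s s' \<longleftrightarrow> s' = s(d := s r)"
proof -
  let ?p = "Seq (Act (Dec r)) (Seq (Act (Inc d)) (Act (Inc t)))" and ?q = "Seq (Act (Dec t)) (Act (Inc r))"
  \<comment> \<open>States after \<open>i\<close> rounds: \<open>\<sigma>\<close> for the loop that
    drains \<open>r\<close> into \<open>d\<close> and \<open>t\<close>, \<open>\<tau>\<close> for
    the loop that restores \<open>r\<close> from \<open>t\<close>.\<close>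
  define \<sigma> \<tau> where "\<sigma> i = s(r := s r - i, d := i, t := i)"
    and "\<tau> i = s(r := i, d := s r, t := s r - i)" for i
  have p: "exec ?p u u' \<longleftrightarrow> 0 < u r \<and> u' = u(r := u r - 1, d := Suc (u d), t := Suc (u t))" for u u'
    using assms(2) by (auto simp: relcompp_apply)
  have q: "exec ?q u u' \<longleftrightarrow> 0 < u t \<and> u' = u(t := u t - 1, r := Suc (u r))" for u u'
    using assms(2) by (auto simp: relcompp_apply)
  have "(\<sigma> i)(r := \<sigma> i r - 1, d := Suc (\<sigma> i d), t := Suc (\<sigma> i t)) = \<sigma> (Suc i)" for i
    using assms(2) by (auto simp: \<sigma>_def fun_eq_iff)
  moreover have "0 < \<sigma> i r \<longleftrightarrow> Suc i \<le> s r" for i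
    using assms(2) by (auto simp: \<sigma>_def)
  ultimately have first: "exec (Star ?p) (\<sigma> 0) u \<longleftrightarrow> (\<exists>i. i \<le> s r \<and> u = \<sigma> i)" for u
    by (intro exec_Star_count) (simp_all add: p del: exec.simps)
  have "(\<tau> i)(t := \<tau> i t - 1, r := Suc (\<tau> i r)) = \<tau> (Suc i)" if "i \<le> s r" for i
    using assms(2) by (auto simp: \<tau>_def fun_eq_iff)
  moreover have "0 < \<tau> i t \<longleftrightarrow> Suc i \<le> s r" for i
    using assms(2) by (auto simp: \<tau>_def)
  ultimately have second: "exec (Star ?q) (\<tau> 0) u \<longleftrightarrow> (\<exists>i. i \<le> s r \<and> u = \<tau> i)" for u
    by (intro exec_Star_count) (simp_all add: q del: exec.simps)
  have eqs: "\<sigma> 0 = s(d := 0)" "\<sigma> (s r) = \<tau> 0" "\<tau> (s r) = s(d := s r)"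
    and tests: "\<sigma> i r = 0 \<longleftrightarrow> s r \<le> i" "\<tau> i t = 0 \<longleftrightarrow> s r \<le> i" for i
    using assms by (auto simp: \<sigma>_def \<tau>_def fun_eq_iff)
  have zeros: "\<tau> 0 r = 0" "s t = 0" "t \<noteq> d"
    using assms by (auto simp: \<tau>_def)
  have first: "exec (Seq (Star ?p) (Act (Test r))) (s(d := 0)) u \<longleftrightarrow> u = \<tau> 0" for u
    using first tests(1) eqs(1,2) zeros by (auto simp: relcompp_apply simp del: exec.simps(3) dest: le_antisym)
  have second: "exec (Seq (Star ?q) (Act (Test t))) (\<tau> 0) u \<longleftrightarrow> u = s(d := s r)" for u
    using second tests(2) eqs(3) zeros by (auto simp: relcompp_apply simp del: exec.simps(3) dest: le_antisym)
  show ?thesis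
    unfolding copy_def exec.simps(2)[of "reset d"] exec.simps(2)[of "Seq (Star ?p) _"]
      relcompp_apply exec_reset using first second by auto
qed

text \<open>The registers from \<open>b\<close> on are scratch space: zero at the start and again at the end.\<close>

definition implements :: "recf \<Rightarrow> nat list \<Rightarrow> nat \<Rightarrow> nat \<Rightarrow> program \<Rightarrow> bool" where
  "implements f rs d b p \<longleftrightarrow>
     (\<forall>s s'. (\<forall>j\<ge>b. s j = 0) \<longrightarrow>
        exec p s s' \<longleftrightarrow> (\<exists>y. computes f (map s rs) y \<and> s' = s(d := y)))"

lemma implementsI:
  assumes "\<And>s s'. (\<And>j. b \<le> j \<Longrightarrow> s j = 0) \<Longrightarrow>
    exec p s s' \<longleftrightarrow> (\<exists>y. computes f (map s rs) y \<and> s' = s(d := y))"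
  shows "implements f rs d b p"
  using assms by (auto simp: implements_def)

lemma implementsD:
  assumes "implements f rs d b p" "\<And>j. b \<le> j \<Longrightarrow> s j = 0"
  shows "exec p s s' \<longleftrightarrow> (\<exists>y. computes f (map s rs) y \<and> s' = s(d := y))"
  using assms by (auto simp: implements_def)

text \<open>A program without runs, for argument lists of a wrong length, on which
  \<open>computes\<close> yields nothing.\<close>

definition stuck :: "nat \<Rightarrow> program" where
  "stuck b = Seq (Act (Inc b)) (Act (Test b))"

lemma exec_stuck: "\<not> exec (stuck b) s s'"
  by (auto simp: stuck_def)

fun store :: "nat \<Rightarrow> nat list \<Rightarrow> (nat \<Rightarrow> nat) \<Rightarrow> nat \<Rightarrow> nat" where
  "store c [] s = s"
| "store c (y # ys) s = store (Suc c) ys (s(c := y))"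

lemma store_apply: "store c ys s j = (if c \<le> j \<and> j < c + length ys then ys ! (j - c) else s j)"
  by (induction ys arbitrary: c s) (auto simp: nth_Cons')

lemma map_store: "map (store c ys s) [c..<c + length ys] = ys"
  by (rule nth_equalityI) (auto simp: store_apply)

lemma exec_clear: "\<exists>p. \<forall>s s'. exec p s s' \<longleftrightarrow> s' = store c (replicate n 0) s"
proof (induction n arbitrary: c)
  case 0
  show ?case by (rule exI[of _ "Act Nop"]) simp
next
  case (Suc n)
  then obtain p where "\<And>s s'. exec p s s' \<longleftrightarrow> s' = store (Suc c) (replicate n 0) s" by blast
  then show ?case
    by (intro exI[of _ "Seq (reset c) p"]) (auto simp: relcompp_apply exec_reset)
qed

text \<open>The results are stored in consecutive registers from \<open>c\<close> on. Those of
  \<open>rs\<close> lie below \<open>c\<close>, so every later function still sees the original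
  arguments.\<close>

lemma implements_list:
  assumes "\<And>g rs d b. g \<in> set gs \<Longrightarrow> set rs \<subseteq> {..<b} - {d} \<Longrightarrow> d < b \<Longrightarrow> \<exists>p. implements g rs d b p"
    and "set rs \<subseteq> {..<c}" "c + length gs \<le> b"
  shows "\<exists>p. \<forall>s s'. (\<forall>j\<ge>b. s j = 0) \<longrightarrow>
    exec p s s' \<longleftrightarrow> (\<exists>ys. list_all2 (\<lambda>g y. computes g (map s rs) y) gs ys \<and> s' = store c ys s)"
  using assms
proof (induction gs arbitrary: c)
  case Nil
  show ?case by (rule exI[of _ "Act Nop"]) simp
next
  case (Cons g gs)
  have "set rs \<subseteq> {..<b} - {c}" "c < b" using Cons.prems(2,3) by auto
  then obtain p where p: "implements g rs c b p"
    using Cons.prems(1)[of g rs b c] by auto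
  have "set rs \<subseteq> {..<Suc c}" "Suc c + length gs \<le> b" using Cons.prems(2,3) by auto
  then obtain q where q: "\<And>s s'. (\<forall>j\<ge>b. s j = 0) \<Longrightarrow>
    exec q s s' \<longleftrightarrow> (\<exists>ys. list_all2 (\<lambda>g y. computes g (map s rs) y) gs ys \<and> s' = store (Suc c) ys s)"
    using Cons.IH[OF Cons.prems(1), of "Suc c"] by (auto 0 0) blast
  have "exec (Seq p q) s s' \<longleftrightarrow>
      (\<exists>ys. list_all2 (\<lambda>g y. computes g (map s rs) y) (g # gs) ys \<and> s' = store c ys s)"
    if "\<forall>j\<ge>b. s j = 0" for s s'
  proof -
    have "exec (Seq p q) s s' \<longleftrightarrow> (\<exists>y. computes g (map s rs) y \<and> exec q (s(c := y)) s')"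
      using implementsD[OF p, of s] that by (auto simp: relcompp_apply)
    also have "\<dots> \<longleftrightarrow> (\<exists>y. computes g (map s rs) y \<and>
        (\<exists>ys. list_all2 (\<lambda>g y. computes g (map s rs) y) gs ys \<and> s' = store (Suc c) ys (s(c := y))))"
    proof -
      have eq: "map (s(c := y)) rs = map s rs" for y using Cons.prems(2) by auto
      have "\<forall>j\<ge>b. (s(c := y)) j = 0" for y using that \<open>c < b\<close> by auto
      from q[OF this] have "exec q (s(c := y)) s' \<longleftrightarrow>
          (\<exists>ys. list_all2 (\<lambda>g y. computes g (map s rs) y) gs ys \<and> s' = store (Suc c) ys (s(c := y)))" for y
        unfolding eq .
      then show ?thesis by (simp only:)
    qed
    also have "\<dots> \<longleftrightarrow> (\<exists>ys. list_all2 (\<lambda>g y. computes g (map s rs) y) (g # gs) ys \<and> s' = store c ys s)"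
      unfolding list_all2_Cons1 by (metis store.simps(2))
    finally show ?thesis .
  qed
  then show ?case by blast
qed

text \<open>An undefined value of \<open>f\<close> appears as the absence of runs, so a loop may
  guess its number of iterations as long as a later test rejects the wrong guesses.\<close>

theorem implementable:
  assumes "set rs \<subseteq> {..<b} - {d}" "d < b"
  shows "\<exists>p. implements f rs d b p"
  using assms
proof (induction f arbitrary: rs d b)
  case Zero
  show ?case
    by (rule exI[of _ "reset d"], rule implementsI) (auto simp: exec_reset computes_iffs)
next
  case Succ
  show ?case
  proof (cases "\<exists>r. rs = [r]")
    case True
    then obtain r where "rs = [r]" by blast
    with Succ show ?thesis
      by (intro exI[of _ "Seq (copy r d b) (Act (Inc d))"] implementsI)
         (auto simp: exec_copy relcompp_apply computes_iffs)
  next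
    case False
    then show ?thesis
      by (intro exI[of _ "stuck b"] implementsI) (auto simp: exec_stuck computes_iffs)
  qed
next
  case (Proj i)
  show ?case
  proof (cases "i < length rs")
    case True
    with Proj have "rs ! i < b" "rs ! i \<noteq> d" using nth_mem[of i rs] by blast+
    with True Proj show ?thesis
      by (intro exI[of _ "copy (rs ! i) d b"] implementsI) (auto simp: exec_copy computes_iffs)
  next
    case False
    then show ?thesis
      by (intro exI[of _ "stuck b"] implementsI) (auto simp: exec_stuck computes_iffs)
  qed
next
  case (Comp f gs)
  \<comment> \<open>The registers from \<open>b\<close> up to \<open>?c\<close> (exclusive) hold the
    argument values of \<open>f\<close>; the scratch space of the subprograms starts at
    \<open>?c\<close>.\<close>
  let ?c = "b + length gs"
  have "set rs \<subseteq> {..<b}" using Comp.prems by auto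
  then obtain p where p: "\<And>s s'. (\<forall>j\<ge>?c. s j = 0) \<Longrightarrow>
    exec p s s' \<longleftrightarrow> (\<exists>ys. list_all2 (\<lambda>g y. computes g (map s rs) y) gs ys \<and> s' = store b ys s)"
    using implements_list[of gs rs b ?c] Comp.IH(2) by blast
  have "set [b..<?c] \<subseteq> {..<?c} - {d}" "d < ?c" using Comp.prems by auto
  then obtain q where q: "implements f [b..<?c] d ?c q" using Comp.IH(1) by blast
  obtain r where r: "\<And>s s'. exec r s s' \<longleftrightarrow> s' = store b (replicate (length gs) 0) s"
    using exec_clear[of b "length gs"] by blast
  have "exec (Seq p (Seq q r)) s s' \<longleftrightarrow> (\<exists>y. computes (Comp f gs) (map s rs) y \<and> s' = s(d := y))"
    if zero: "\<And>j. b \<le> j \<Longrightarrow> s j = 0" for s s'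
  proof -
    have q': "exec q (store b ys s) t \<longleftrightarrow> (\<exists>y. computes f ys y \<and> t = (store b ys s)(d := y))"
      if "length ys = length gs" for ys t
      using implementsD[OF q, of "store b ys s"] that zero map_store[of b ys s] by (simp add: store_apply)
    have r': "store b (replicate (length gs) 0) ((store b ys s)(d := y)) = s(d := y)"
      if "length ys = length gs" for ys y
      using that zero Comp.prems by (auto simp: store_apply fun_eq_iff)
    have main: "(\<exists>t. exec q (store b ys s) t \<and> exec r t s') \<longleftrightarrow> (\<exists>y. computes f ys y \<and> s' = s(d := y))"
      if "list_all2 (\<lambda>g y. computes g (map s rs) y) gs ys" for ys
    proof -
      have len: "length ys = length gs" using that by (simp add: list_all2_lengthD)
      show ?thesis unfolding q'[OF len] r using r'[OF len] by metis
    qed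
    have p': "exec p s t \<longleftrightarrow>
        (\<exists>ys. list_all2 (\<lambda>g y. computes g (map s rs) y) gs ys \<and> t = store b ys s)" for t
      using p zero by simp
    have "exec (Seq p (Seq q r)) s s' \<longleftrightarrow> (\<exists>ys. list_all2 (\<lambda>g y. computes g (map s rs) y) gs ys \<and>
        (\<exists>t. exec q (store b ys s) t \<and> exec r t s'))"
      unfolding exec.simps(2) relcompp_apply p' by blast
    also have "\<dots> \<longleftrightarrow> (\<exists>ys. list_all2 (\<lambda>g y. computes g (map s rs) y) gs ys \<and>
        (\<exists>y. computes f ys y \<and> s' = s(d := y)))"
      by (intro ex_cong1 conj_cong refl main)
    finally show ?thesis unfolding computes_Comp_iff by blast
  qed
  then have "implements (Comp f gs) rs d b (Seq p (Seq q r))" by (rule implementsI)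
  then show ?case by blast
next
  case (Prim_Rec f g)
  show ?case
  proof (cases rs)
    case Nil
    then show ?thesis
      by (intro exI[of _ "stuck b"] implementsI) (auto simp: exec_stuck computes_iffs)
  next
    case (Cons n xs)
    \<comment> \<open>Register \<open>b\<close> holds the index of the round, \<open>b + 1\<close>
      the value reached so far, \<open>b + 2\<close> the new value returned by \<open>g\<close>, and
      \<open>b + 3\<close> the number of rounds that remain.\<close>
    let ?b = "b + 4"
    have sub: "set xs \<subseteq> {..<?b} - {b + 1}" "set (b # (b + 1) # xs) \<subseteq> {..<?b} - {b + 2}"
      and n: "n < b" "n \<noteq> d" "set xs \<subseteq> {..<b}"
      using Prim_Rec.prems Cons by auto
    obtain p where p: "implements f xs (b + 1) ?b p"
      using Prim_Rec.IH(1)[OF sub(1)] by auto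
    obtain q where q: "implements g (b # (b + 1) # xs) (b + 2) ?b q"
      using Prim_Rec.IH(2)[OF sub(2)] by auto
    let ?body = "Seq (Act (Dec (b + 3))) (Seq q (Seq (copy (b + 2) (b + 1) ?b) (Seq (reset (b + 2)) (Act (Inc b)))))"
    let ?last = "Seq (Act (Test (b + 3))) (Seq (copy (b + 1) d ?b) (Seq (reset b) (reset (b + 1))))"
    let ?p = "Seq (copy n (b + 3) ?b) (Seq p (Seq (Star ?body) ?last))"
    have "exec ?p s s' \<longleftrightarrow> (\<exists>y. computes (Prim_Rec f g) (map s rs) y \<and> s' = s(d := y))"
      if zero: "\<And>j. b \<le> j \<Longrightarrow> s j = 0" for s s'
    proof -
      define \<sigma> where "\<sigma> i r = s(b := i, b + 1 := r, b + 3 := s n - i)" for i r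
      have body: "exec ?body (\<sigma> i r) t \<longleftrightarrow>
          (\<exists>r'. (i < s n \<and> computes g (i # r # map s xs) r') \<and> t = \<sigma> (Suc i) r')" for i r t
      proof -
        let ?s = "(\<sigma> i r)(b + 3 := s n - Suc i)"
        have dec: "act (Dec (b + 3)) (\<sigma> i r) u \<longleftrightarrow> i < s n \<and> u = ?s" for u
          by (auto simp: \<sigma>_def)
        have args: "map ?s (b # (b + 1) # xs) = i # r # map s xs"
          using n(3) by (auto simp: \<sigma>_def)
        have "exec q ?s u \<longleftrightarrow> (\<exists>y. computes g (map ?s (b # (b + 1) # xs)) y \<and> u = ?s(b + 2 := y))" for u
          by (rule implementsD[OF q]) (use zero in \<open>simp add: \<sigma>_def\<close>)
        note q = this[unfolded args]
        have copy: "exec (copy (b + 2) (b + 1) ?b) (?s(b + 2 := y)) u \<longleftrightarrow> u = ?s(b + 2 := y, b + 1 := y)" for y u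
          using zero by (subst exec_copy) (auto simp: \<sigma>_def)
        have "?s(b + 2 := y, b + 1 := y, b + 2 := 0, b := Suc i) = \<sigma> (Suc i) y" for y
          using zero by (auto simp: \<sigma>_def fun_eq_iff)
        moreover have "(?s(b + 2 := y, b + 1 := y, b + 2 := 0)) b = i" for y
          by (simp add: \<sigma>_def)
        ultimately have rest: "exec (Seq (copy (b + 2) (b + 1) ?b) (Seq (reset (b + 2)) (Act (Inc b)))) (?s(b + 2 := y)) u
            \<longleftrightarrow> u = \<sigma> (Suc i) y" for y u
          unfolding exec.simps relcompp_apply exec_reset copy act.simps by metis
        have "exec ?body (\<sigma> i r) u \<longleftrightarrow> i < s n \<and> (\<exists>y. computes g (i # r # map s xs) y \<and>
          exec (Seq (copy (b + 2) (b + 1) ?b) (Seq (reset (b + 2)) (Act (Inc b)))) (?s(b + 2 := y)) u)" for u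
          unfolding exec.simps(2)[of "Act (Dec (b + 3))"] exec.simps(2)[of q] exec.simps(1)
            relcompp_apply[of "exec q"] relcompp_apply[of "act (Dec (b + 3))"] dec q
          by (auto simp: q simp del: exec.simps)
        then show ?thesis unfolding rest by (auto simp del: exec.simps)
      qed
      have start: "exec (Seq (copy n (b + 3) ?b) p) s u \<longleftrightarrow>
          (\<exists>r. computes (Prim_Rec f g) (0 # map s xs) r \<and> u = \<sigma> 0 r)" for u
      proof -
        have "s(b + 3 := s n, b + 1 := r) = \<sigma> 0 r" for r
          using zero by (auto simp: \<sigma>_def fun_eq_iff)
        moreover have "exec (copy n (b + 3) ?b) s v \<longleftrightarrow> v = s(b + 3 := s n)" for v
          using zero n by (subst exec_copy) auto
        moreover have "exec p (s(b + 3 := s n)) v \<longleftrightarrow>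
            (\<exists>y. computes f (map s xs) y \<and> v = s(b + 3 := s n, b + 1 := y))" for v
        proof -
          have "map (s(b + 3 := s n)) xs = map s xs" using n(3) by auto
          moreover have "exec p (s(b + 3 := s n)) v \<longleftrightarrow> (\<exists>y. computes f (map (s(b + 3 := s n)) xs) y \<and>
              v = s(b + 3 := s n, b + 1 := y))"
            by (rule implementsD[OF p]) (use zero in simp)
          ultimately show ?thesis by (simp only:)
        qed
        ultimately show ?thesis by (auto simp: relcompp_apply computes_iffs)
      qed
      have last: "exec ?last (\<sigma> i r) u \<longleftrightarrow> s n \<le> i \<and> u = (\<sigma> i r)(d := r, b := 0, b + 1 := 0)" for i r u
      proof -
        have "exec (copy (b + 1) d ?b) (\<sigma> i r) v \<longleftrightarrow> v = (\<sigma> i r)(d := r)" for v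
          using zero Prim_Rec.prems by (subst exec_copy) (auto simp: \<sigma>_def)
        then show ?thesis
          by (simp add: relcompp_apply exec_reset) (auto simp: \<sigma>_def)
      qed
      have loop: "(\<exists>r. computes (Prim_Rec f g) (0 # map s xs) r \<and> exec (Star ?body) (\<sigma> 0 r) u) \<longleftrightarrow>
          (\<exists>i r. (i \<le> s n \<and> computes (Prim_Rec f g) (i # map s xs) r) \<and> u = \<sigma> i r)" for u
      proof -
        have chain: "(Suc i \<le> s n \<and> computes (Prim_Rec f g) (Suc i # map s xs) r') \<longleftrightarrow>
            (\<exists>r. (i \<le> s n \<and> computes (Prim_Rec f g) (i # map s xs) r) \<and>
              i < s n \<and> computes g (i # r # map s xs) r')" for i r'
          by (auto simp: computes_iffs)
        show ?thesis
          using exec_Star_iff[where P = "\<lambda>i r. i \<le> s n \<and> computes (Prim_Rec f g) (i # map s xs) r"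
              and Q = "\<lambda>i r r'. i < s n \<and> computes g (i # r # map s xs) r'", OF body chain, of u]
          by (simp only: le0 simp_thms)
      qed
      have "exec ?p s s' \<longleftrightarrow> (\<exists>u v. exec (Seq (copy n (b + 3) ?b) p) s u \<and> exec (Star ?body) u v \<and> exec ?last v s')"
      proof -
        have "exec ?p = exec (Seq (copy n (b + 3) ?b) p) OO exec (Star ?body) OO exec ?last"
          by (simp only: exec.simps(2) relcompp_assoc)
        then show ?thesis by (auto simp add: relcompp_apply simp del: exec.simps)
      qed
      also have "\<dots> \<longleftrightarrow> (\<exists>v. (\<exists>r. computes (Prim_Rec f g) (0 # map s xs) r \<and> exec (Star ?body) (\<sigma> 0 r) v) \<and> exec ?last v s')"
        unfolding start by blast
      \<comment> \<open>The loop gives \<open>i \<le> s n\<close> and the final test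
        \<open>s n \<le> i\<close>, so only the run with exactly \<open>s n\<close> rounds
        survives.\<close>
      also have "\<dots> \<longleftrightarrow> (\<exists>r. computes (Prim_Rec f g) (s n # map s xs) r \<and> exec ?last (\<sigma> (s n) r) s')"
        unfolding loop using last by (auto simp del: exec.simps dest: le_antisym)
      also have "\<dots> \<longleftrightarrow> (\<exists>r. computes (Prim_Rec f g) (s n # map s xs) r \<and> s' = s(d := r))"
      proof -
        have "(\<sigma> (s n) r)(d := r, b := 0, b + 1 := 0) = s(d := r)" for r
          using zero Prim_Rec.prems(2) by (auto simp: \<sigma>_def fun_eq_iff)
        then show ?thesis using last by simp
      qed
      finally show ?thesis using Cons by simp
    qed
    then have "implements (Prim_Rec f g) rs d b ?p" by (rule implementsI)
    then show ?thesis by blast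
  qed
next
  case (Mu f)
  \<comment> \<open>Register \<open>b\<close> holds the candidate, \<open>b + 1\<close> the value of
    \<open>f\<close> at it, and \<open>b + 2\<close> serves \<open>copy\<close>. The
    \<open>Dec\<close> in the body lets a round pass only if this value is positive.\<close>
  let ?b = "b + 3"
  have "set (b # rs) \<subseteq> {..<?b} - {b + 1}" "b + 1 < ?b" using Mu.prems by auto
  then obtain p where p: "implements f (b # rs) (b + 1) ?b p" using Mu.IH by blast
  let ?body = "Seq p (Seq (Act (Dec (b + 1))) (Seq (reset (b + 1)) (Act (Inc b))))"
  let ?last = "Seq p (Seq (Act (Test (b + 1))) (Seq (copy b d (b + 2)) (reset b)))"
  have "exec (Seq (Star ?body) ?last) s s' \<longleftrightarrow> (\<exists>y. computes (Mu f) (map s rs) y \<and> s' = s(d := y))"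
    if zero: "\<And>j. b \<le> j \<Longrightarrow> s j = 0" for s s'
  proof -
    define \<sigma> where "\<sigma> i = s(b := i)" for i
    have exec_p: "exec p (\<sigma> i) u \<longleftrightarrow> (\<exists>y. computes f (i # map s rs) y \<and> u = (\<sigma> i)(b + 1 := y))" for i u
    proof -
      have "map (\<sigma> i) (b # rs) = i # map s rs" using Mu.prems by (auto simp: \<sigma>_def)
      moreover have "exec p (\<sigma> i) u \<longleftrightarrow>
          (\<exists>y. computes f (map (\<sigma> i) (b # rs)) y \<and> u = (\<sigma> i)(b + 1 := y))"
        by (rule implementsD[OF p]) (use zero in \<open>simp add: \<sigma>_def\<close>)
      ultimately show ?thesis by (simp only:)
    qed
    have "exec (Seq (Act (Dec (b + 1))) (Seq (reset (b + 1)) (Act (Inc b)))) v u \<longleftrightarrow>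
        0 < v (b + 1) \<and> u = v(b + 1 := 0, b := Suc (v b))" for u v
      by (auto simp: relcompp_apply exec_reset)
    then have "exec ?body (\<sigma> i) u \<longleftrightarrow> (\<exists>y. computes f (i # map s rs) y \<and>
        0 < y \<and> u = (\<sigma> i)(b + 1 := 0, b := Suc i))" for i u
      unfolding exec.simps(2)[of p] relcompp_apply exec_p by (auto simp: \<sigma>_def)
    moreover have "(\<sigma> i)(b + 1 := 0, b := Suc i) = \<sigma> (Suc i)" for i
      using zero by (auto simp: \<sigma>_def fun_eq_iff)
    ultimately have body: "exec ?body (\<sigma> i) u \<longleftrightarrow>
        (\<exists>y. computes f (i # map s rs) (Suc y)) \<and> u = \<sigma> (Suc i)" for i u
      by (metis gr0_conv_Suc)
    have rest: "exec (Seq (Act (Test (b + 1))) (Seq (copy b d (b + 2)) (reset b))) ((\<sigma> i)(b + 1 := y)) u \<longleftrightarrow>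
        y = 0 \<and> u = s(d := i)" for i y u
    proof -
      have "exec (copy b d (b + 2)) ((\<sigma> i)(b + 1 := 0)) v \<longleftrightarrow> v = (\<sigma> i)(b + 1 := 0, d := i)" for v
        using zero Mu.prems by (subst exec_copy) (auto simp: \<sigma>_def)
      moreover have "(\<sigma> i)(b + 1 := 0, d := i, b := 0) = s(d := i)"
        using zero Mu.prems by (auto simp: \<sigma>_def fun_eq_iff)
      ultimately show ?thesis
        by (cases "y = 0") (simp_all add: relcompp_apply exec_reset)
    qed
    have last: "exec ?last (\<sigma> i) u \<longleftrightarrow> computes f (i # map s rs) 0 \<and> u = s(d := i)" for i u
    proof -
      have "exec ?last (\<sigma> i) u \<longleftrightarrow> (\<exists>y. computes f (i # map s rs) y \<and>
          exec (Seq (Act (Test (b + 1))) (Seq (copy b d (b + 2)) (reset b))) ((\<sigma> i)(b + 1 := y)) u)"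
        unfolding exec.simps(2)[of p] relcompp_apply[of "exec p"] exec_p by (auto simp del: exec.simps)
      then show ?thesis unfolding rest by (auto simp del: exec.simps)
    qed
    have "exec (Star ?body) (\<sigma> 0) u \<longleftrightarrow>
        (\<exists>i. (\<forall>m<i. \<exists>y. computes f (m # map s rs) (Suc y)) \<and> u = \<sigma> i)" for u
      proof (rule exec_Star_count)
      show "(\<forall>m<i. \<exists>y. computes f (m # map s rs) (Suc y)) \<Longrightarrow> exec ?body (\<sigma> i) t \<longleftrightarrow>
          (\<forall>m<Suc i. \<exists>y. computes f (m # map s rs) (Suc y)) \<and> t = \<sigma> (Suc i)" for i t
        unfolding body by (auto simp: less_Suc_eq)
    qed auto
    note loop = this
    have "\<sigma> 0 = s" using zero by (auto simp: \<sigma>_def)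
    then have "exec (Seq (Star ?body) ?last) s s' \<longleftrightarrow>
        (\<exists>i. (\<forall>m<i. \<exists>y. computes f (m # map s rs) (Suc y)) \<and> exec ?last (\<sigma> i) s')"
      unfolding exec.simps(2)[of "Star ?body"] relcompp_apply[of "exec (Star ?body)"]
      using loop by (auto simp del: exec.simps)
    then show ?thesis unfolding last computes_Mu_iff by blast
  qed
  then have "implements (Mu f) rs d b (Seq (Star ?body) ?last)" by (rule implementsI)
  then show ?case by blast
qed

section \<open>Counter systems\<close>

text \<open>The control state of a running program is the stack of the programs that remain to be run.\<close>

fun succs :: "program list \<Rightarrow> (action \<times> program list) set" where
  "succs [] = {}"
| "succs (Act a # ps) = {(a, ps)}"
| "succs (Seq p q # ps) = {(Nop, p # q # ps)}"
| "succs (Star p # ps) = {(Nop, ps), (Nop, p # Star p # ps)}"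

definition step :: "program list \<times> (nat \<Rightarrow> nat) \<Rightarrow> program list \<times> (nat \<Rightarrow> nat) \<Rightarrow> bool" where
  "step c c' \<longleftrightarrow> (\<exists>a. (a, fst c') \<in> succs (fst c) \<and> act a (snd c) (snd c'))"

lemma exec_imp_steps: "exec p s s' \<Longrightarrow> step\<^sup>*\<^sup>* (p # ps, s) (ps, s')"
proof (induction p arbitrary: ps s s')
  case (Act a)
  then show ?case by (auto simp: step_def)
next
  case (Seq p q)
  then obtain t where "exec p s t" "exec q t s'" by auto
  with Seq.IH have "step\<^sup>*\<^sup>* (p # q # ps, s) (ps, s')" by (meson rtranclp_trans)
  moreover have "step (Seq p q # ps, s) (p # q # ps, s)" by (auto simp: step_def)
  ultimately show ?case by (rule converse_rtranclp_into_rtranclp[rotated])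
next
  case (Star p)
  then have "(exec p)\<^sup>*\<^sup>* s s'" by simp
  then show ?case
  proof (induction rule: converse_rtranclp_induct)
    case base
    have "step (Star p # ps, s') (ps, s')" by (auto simp: step_def)
    then show ?case by blast
  next
    case (step s t)
    have "step (Star p # ps, s) (p # Star p # ps, s)" by (auto simp: step_def)
    moreover have "step\<^sup>*\<^sup>* (p # Star p # ps, s) (Star p # ps, t)"
      using Star.IH step.hyps(1) by blast
    ultimately show ?case
      using step.IH by (meson converse_rtranclp_into_rtranclp rtranclp_trans)
  qed
qed

fun exec_stack :: "program list \<Rightarrow> (nat \<Rightarrow> nat) \<Rightarrow> (nat \<Rightarrow> nat) \<Rightarrow> bool" where
  "exec_stack [] = (=)"
| "exec_stack (p # ps) = exec p OO exec_stack ps"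

text \<open>\<open>exec_stack\<close> reads the stack as a sequential composition. Being carried
  backwards along steps, it spreads from the empty stack, where it is equality, to every
  configuration that can reach it.\<close>

lemma step_exec_stack:
  assumes "step c c'" "exec_stack (fst c') (snd c') s'"
  shows "exec_stack (fst c) (snd c) s'"
proof (cases c)
  case (Pair ps s)
  with assms show ?thesis
    by (cases ps rule: succs.cases)
       (auto simp: step_def relcompp_apply, metis converse_rtranclp_into_rtranclp)
qed

lemma steps_imp_exec:
  assumes "step\<^sup>*\<^sup>* ([p], s) ([], s')"
  shows "exec p s s'"
proof -
  have "exec_stack (fst c) (snd c) s'" if "step\<^sup>*\<^sup>* c ([], s')" for c
    using that by (induction rule: converse_rtranclp_induct) (auto intro: step_exec_stack)
  from this[OF assms] show ?thesis by auto
qed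

text \<open>These are the control states of a run of \<open>p\<close> on top of \<open>ps\<close>,
  before only \<open>ps\<close> is left. A loop is put back unchanged below its body, so finitely
  many stacks suffice for unboundedly many rounds; this makes the program counter and the set of
  instructions finite.\<close>

fun stacks :: "program \<Rightarrow> program list \<Rightarrow> program list set" where
  "stacks (Act a) ps = {Act a # ps}"
| "stacks (Seq p q) ps = insert (Seq p q # ps) (stacks p (q # ps) \<union> stacks q ps)"
| "stacks (Star p) ps = insert (Star p # ps) (stacks p (Star p # ps))"

lemma finite_stacks: "finite (stacks p ps)"
  by (induction p arbitrary: ps) auto

lemma top_in_stacks: "p # ps \<in> stacks p ps"
  by (cases p) auto

lemma succs_stacks: "x \<in> stacks p ps \<Longrightarrow> (a, y) \<in> succs x \<Longrightarrow> y \<in> insert ps (stacks p ps)"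
proof (induction p arbitrary: ps)
  case (Seq p q)
  then show ?case using top_in_stacks[of p "q # ps"] top_in_stacks[of q ps] by auto
next
  case (Star p)
  then show ?case using top_in_stacks[of p "Star p # ps"] by auto
qed auto

lemma finite_succs: "finite (succs x)"
  by (cases x rule: succs.cases) auto

text \<open>
  In a counter system, the letters of a word are instructions: \<open>\<delta>\<close> gives the increments of the
  counters, and \<open>lo\<close> the lower bounds they need, which \<open>tz\<close> turns into equality tests. There are no
  states, since a program counter tested for equality does the same.
\<close>

definition counter :: "(nat \<Rightarrow> nat \<Rightarrow> int) \<Rightarrow> nat list \<Rightarrow> nat \<Rightarrow> int" where
  "counter \<delta> w j = (\<Sum>k\<leftarrow>w. \<delta> k j)"

definition allowed :: "int \<Rightarrow> int \<Rightarrow> int \<Rightarrow> bool" where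
  "allowed c l z \<longleftrightarrow> l \<le> c \<and> (c = l \<or> z = 0)"

definition legal ::
    "nat \<Rightarrow> (nat \<Rightarrow> nat \<Rightarrow> int) \<Rightarrow> (nat \<Rightarrow> nat \<Rightarrow> int) \<Rightarrow> (nat \<Rightarrow> nat \<Rightarrow> int) \<Rightarrow> nat list \<Rightarrow> bool" where
  "legal R \<delta> lo tz w \<longleftrightarrow>
     (\<forall>m<length w. \<forall>j<R. allowed (counter \<delta> (take m w) j) (lo (w ! m) j) (tz (w ! m) j))"

lemma counter_Nil [simp]: "counter \<delta> [] j = 0"
  and counter_snoc [simp]: "counter \<delta> (w @ [k]) j = counter \<delta> w j + \<delta> k j"
  by (simp_all add: counter_def)

lemma legal_Nil [simp]: "legal R \<delta> lo tz []"
  by (simp add: legal_def)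

lemma legal_snoc [simp]:
  "legal R \<delta> lo tz (w @ [k]) \<longleftrightarrow>
     legal R \<delta> lo tz w \<and> (\<forall>j<R. allowed (counter \<delta> w j) (lo k j) (tz k j))"
  by (auto simp: legal_def nth_append less_Suc_eq)

text \<open>The bounds are those of the networks: the coefficients of a second difference have
  absolute sum 4, so ramp weights are at most \<open>K\<close>; the longest rows of
  \<open>check_net\<close> have \<open>4 * R + 2\<close> entries; \<open>hlt\<close> is a bias
  there. Features vanish outside \<open>{1..K}\<close> so that finitely many ramps represent
  them.\<close>

locale counter_system =
  fixes K R :: nat and \<delta> lo tz :: "nat \<Rightarrow> nat \<Rightarrow> int" and hlt :: int
  assumes features_bounded: "4 * \<bar>\<delta> k j\<bar> \<le> int K" "4 * \<bar>lo k j\<bar> \<le> int K" "4 * \<bar>tz k j\<bar> \<le> int K"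
    and features_outside: "k \<notin> {1..K} \<Longrightarrow> \<delta> k j = 0" "k \<notin> {1..K} \<Longrightarrow> lo k j = 0" "k \<notin> {1..K} \<Longrightarrow> tz k j = 0"
    and tz: "tz k j = 0 \<or> tz k j = 1"
    and R: "2 \<le> R" "4 * R + 2 \<le> K"
    and hlt: "\<bar>hlt\<bar> \<le> int K"

fun action_delta :: "action \<Rightarrow> nat \<Rightarrow> int" where
  "action_delta (Inc i) j = (if i = j then 1 else 0)"
| "action_delta (Dec i) j = (if i = j then - 1 else 0)"
| "action_delta _ j = 0"

fun action_low :: "action \<Rightarrow> nat \<Rightarrow> int" where
  "action_low (Dec i) j = (if i = j then 1 else 0)"
| "action_low _ j = 0"

fun action_test :: "action \<Rightarrow> nat \<Rightarrow> int" where
  "action_test (Test i) j = (if i = j then 1 else 0)"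
| "action_test _ j = 0"

fun register :: "action \<Rightarrow> nat" where
  "register (Inc i) = i"
| "register (Dec i) = i"
| "register (Test i) = i"
| "register Nop = 0"

text \<open>Guards only decide whether an action can fire. Its effect is determined by the state and
  is recorded separately, by the increments in \<open>act_delta\<close>.\<close>

lemma act_enabled_iff:
  assumes "register a < r" "\<And>j. j < r \<Longrightarrow> c j = int (s j)"
  shows "(\<exists>s'. act a s s') \<longleftrightarrow> (\<forall>j<r. allowed (c j) (action_low a j) (action_test a j))"
  using assms by (cases a) (auto simp: allowed_def)

lemma act_delta: "act a s s' \<Longrightarrow> int (s' j) = int (s j) + action_delta a j"
  by (cases a) auto

text \<open>Every transition between control stacks becomes a letter, tied to its source by an
  equality test of the program counter. Completeness finds a word over \<open>{1..K}\<close>,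
  whereas soundness covers all words, because the alphabet of the instance will be larger than
  \<open>K\<close>.\<close>

theorem counter_system_of_program:
  obtains K R \<delta> lo tz hlt where "counter_system K R \<delta> lo tz hlt"
    and "\<forall>s. exec p (\<lambda>_. 0) s \<longrightarrow>
      (\<exists>w. set w \<subseteq> {1..K} \<and> legal R \<delta> lo tz w \<and> counter \<delta> w 0 = hlt \<and> counter \<delta> w 1 = int (s 0))"
    and "\<forall>w. legal R \<delta> lo tz w \<and> counter \<delta> w 0 = hlt \<longrightarrow>
      (\<exists>s. exec p (\<lambda>_. 0) s \<and> counter \<delta> w 1 = int (s 0))"
proof -
  let ?X = "insert [] (stacks p [])"
  define \<Delta> where "\<Delta> = {(x, a, y). x \<in> stacks p [] \<and> (a, y) \<in> succs x}"
  have "\<Delta> = Sigma (stacks p []) succs" by (auto simp: \<Delta>_def)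
  then have "finite \<Delta>" by (auto simp: finite_stacks finite_succs)
  then obtain ts where ts: "set ts = \<Delta>" using finite_list by blast
  obtain r where r: "\<And>x a y. (x, a, y) \<in> \<Delta> \<Longrightarrow> register a < r"
  proof -
    have "finite ((\<lambda>(x, a, y). register a) ` \<Delta>)" using \<open>finite \<Delta>\<close> by simp
    then obtain m where "\<forall>i \<in> (\<lambda>(x, a, y). register a) ` \<Delta>. i < m"
      unfolding finite_nat_set_iff_bounded by blast
    then show ?thesis using that[of m] by force
  qed
  obtain idx :: "program list \<Rightarrow> nat" where inj: "inj_on idx ?X"
    using finite_imp_inj_to_nat_seg[of ?X] finite_stacks by auto
  have "finite (idx ` ?X)" using finite_stacks by simp
  then obtain b where b: "\<And>x. x \<in> ?X \<Longrightarrow> idx x < b"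
    unfolding finite_nat_set_iff_bounded by blast
  \<comment> \<open>Counter 0 is the program counter and counter \<open>Suc j\<close> is register
    \<open>j\<close>. The maximum with 1 ensures that register 0, which holds the result, is among
    them.\<close>
  define R where "R = Suc (max r 1)"
  \<comment> \<open>Only the letters up to \<open>length ts\<close> are transitions; the other
    summands make room for the size bounds of the locale.\<close>
  define K where "K = length ts + 4 * b + 4 * R + 4"
  \<comment> \<open>Counters start at 0, so the numbering is shifted to give the initial stack
    \<open>[p]\<close> the value 0.\<close>
  define pc where "pc x = int (idx x) - int (idx [p])" for x
  define \<delta> where "\<delta> k j = (if k \<in> {1..length ts} then
      (case ts ! (k - 1) of (x, a, y) \<Rightarrow>
        case j of 0 \<Rightarrow> pc y - pc x | Suc i \<Rightarrow> action_delta a i) else 0)" for k j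
  define lo where "lo k j = (if k \<in> {1..length ts} then
      (case ts ! (k - 1) of (x, a, y) \<Rightarrow> case j of 0 \<Rightarrow> pc x | Suc i \<Rightarrow> action_low a i) else 0)" for k j
  define tz where "tz k j = (if k \<in> {1..length ts} then
      (case ts ! (k - 1) of (x, a, y) \<Rightarrow> case j of 0 \<Rightarrow> 1 | Suc i \<Rightarrow> action_test a i) else 0)" for k j
  have in_\<Delta>: "x \<in> ?X \<and> y \<in> ?X \<and> x \<in> stacks p [] \<and> (a, y) \<in> succs x" if "(x, a, y) \<in> \<Delta>" for x a y
    using that succs_stacks[of x p "[]"] by (auto simp: \<Delta>_def)
  have start: "[p] \<in> ?X" using top_in_stacks by simp
  have pc_bound: "\<bar>pc x\<bar> \<le> int b" if "x \<in> ?X" for x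
    using b[OF that] b[OF start] by (auto simp: pc_def)
  have letter: "ts ! (k - 1) \<in> \<Delta>" if "k \<in> {1..length ts}" for k
    using that nth_mem[of "k - 1" ts] ts by auto
  have action_bounds: "\<bar>action_delta a j\<bar> \<le> 1" "\<bar>action_low a j\<bar> \<le> 1" "\<bar>action_test a j\<bar> \<le> 1" for a j
    by (cases a; simp)+
  have system: "counter_system K R \<delta> lo tz (pc [])"
  proof
    have b1: "1 \<le> b" using b[OF start] by simp
    show "4 * \<bar>\<delta> k j\<bar> \<le> int K" for k j
    proof (cases "k \<in> {1..length ts}")
      case True
      obtain x a y where t: "ts ! (k - 1) = (x, a, y)" by (cases "ts ! (k - 1)")
      with letter[OF True] in_\<Delta> b have "idx x < b" "idx y < b" by metis+
      then have "\<bar>pc y - pc x\<bar> \<le> int b" by (auto simp: pc_def)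
      moreover have "\<delta> k j = (case j of 0 \<Rightarrow> pc y - pc x | Suc i \<Rightarrow> action_delta a i)"
        using True t by (simp add: \<delta>_def)
      ultimately have "\<bar>\<delta> k j\<bar> \<le> int b + 1"
        using action_bounds(1)[of a "j - 1"] by (cases j) auto
      then show ?thesis by (simp add: K_def)
    qed (auto simp: \<delta>_def)
    show "4 * \<bar>lo k j\<bar> \<le> int K" for k j
    proof (cases "k \<in> {1..length ts}")
      case True
      obtain x a y where t: "ts ! (k - 1) = (x, a, y)" by (cases "ts ! (k - 1)")
      with letter[OF True] in_\<Delta> pc_bound have "\<bar>pc x\<bar> \<le> int b" by metis
      with True t have "\<bar>lo k j\<bar> \<le> int b + 1"
        using action_bounds(2)[of a "j - 1"] by (cases j) (auto simp: lo_def)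
      then show ?thesis by (simp add: K_def)
    qed (auto simp: lo_def)
    show "4 * \<bar>tz k j\<bar> \<le> int K" for k j
    proof (cases "k \<in> {1..length ts}")
      case True
      obtain x a y where t: "ts ! (k - 1) = (x, a, y)" by (cases "ts ! (k - 1)")
      with True have "\<bar>tz k j\<bar> \<le> int b + 1"
        using action_bounds(3)[of a "j - 1"] by (cases j) (auto simp: tz_def)
      then show ?thesis by (simp add: K_def)
    qed (auto simp: tz_def)
    show "tz k j = 0 \<or> tz k j = 1" for k j
      by (cases "ts ! (k - 1)", cases "fst (snd (ts ! (k - 1)))"; cases j) (auto simp: tz_def)
    show "\<bar>pc []\<bar> \<le> int K" using pc_bound[of "[]"] by (auto simp: K_def)
  qed (auto simp: R_def K_def \<delta>_def lo_def tz_def)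
  have pc_eq: "pc x = pc y \<longleftrightarrow> x = y" if "x \<in> ?X" "y \<in> ?X" for x y
    using inj_on_eq_iff[OF inj that] by (simp add: pc_def)
  have enabled: "(\<forall>j<R. allowed (c j) (lo k j) (tz k j)) \<longleftrightarrow> u = x \<and> (\<exists>s'. act a s s')"
    if k: "k \<in> {1..length ts}" and t: "ts ! (k - 1) = (x, a, y)" and u: "u \<in> ?X"
      and c: "c 0 = pc u" "\<And>j. j < max r 1 \<Longrightarrow> c (Suc j) = int (s j)" for c k u x a y s
  proof -
    have xay: "(x, a, y) \<in> \<Delta>" using letter[OF k] t by simp
    have "(\<forall>j<R. allowed (c j) (lo k j) (tz k j)) \<longleftrightarrow>
        allowed (c 0) (lo k 0) (tz k 0) \<and> (\<forall>j<max r 1. allowed (c (Suc j)) (lo k (Suc j)) (tz k (Suc j)))"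
      unfolding R_def using All_less_Suc2 by simp
    also have "allowed (c 0) (lo k 0) (tz k 0) \<longleftrightarrow> u = x"
      using k t c(1) pc_eq[OF u, of x] in_\<Delta>[OF xay] by (auto simp: allowed_def lo_def tz_def)
    also have "(\<forall>j<max r 1. allowed (c (Suc j)) (lo k (Suc j)) (tz k (Suc j))) \<longleftrightarrow> (\<exists>s'. act a s s')"
      using k t c(2) r[OF xay] by (subst act_enabled_iff[where r = "max r 1" and c = "\<lambda>j. c (Suc j)"])
        (auto simp: lo_def tz_def)
    finally show ?thesis .
  qed
  show thesis
  proof (rule that[OF system]; intro allI impI; (elim conjE)?)
    fix s
    assume "exec p (\<lambda>_. 0) s"
    moreover have "u \<in> ?X \<and> (\<exists>w. set w \<subseteq> {1..K} \<and> legal R \<delta> lo tz w \<and> counter \<delta> w 0 = pc u \<and>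
        (\<forall>j<max r 1. counter \<delta> w (Suc j) = int (s j)))"
      if "step\<^sup>*\<^sup>* ([p], \<lambda>_. 0) (u, s)" for u s
      using that
    proof (induction rule: rtranclp_induct2)
      case refl
      show ?case using start by (auto intro!: exI[of _ "[]"] simp: pc_def)
    next
      case (step u s v s')
      then obtain w a where w: "set w \<subseteq> {1..K}" "legal R \<delta> lo tz w" "counter \<delta> w 0 = pc u"
        "\<forall>j<max r 1. counter \<delta> w (Suc j) = int (s j)" and u: "u \<in> ?X"
        and a: "(a, v) \<in> succs u" "act a s s'"
        by (auto simp: step_def)
      then have "(u, a, v) \<in> \<Delta>" by (auto simp: \<Delta>_def)
      then obtain i where i: "i < length ts" "ts ! i = (u, a, v)"
        using ts by (metis in_set_conv_nth)
      have "legal R \<delta> lo tz (w @ [Suc i])"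
        using enabled[of "Suc i" u a v u "counter \<delta> w" s] w i a u by auto
      moreover have "counter \<delta> (w @ [Suc i]) 0 = pc v"
        "\<forall>j<max r 1. counter \<delta> (w @ [Suc i]) (Suc j) = int (s' j)"
        using w i act_delta[OF a(2)] by (auto simp: \<delta>_def)
      moreover have "set (w @ [Suc i]) \<subseteq> {1..K}" using w(1) i(1) by (auto simp: K_def)
      moreover have "v \<in> ?X" using in_\<Delta>[OF \<open>(u, a, v) \<in> \<Delta>\<close>] by simp
      ultimately show ?case by blast
    qed
    ultimately obtain w where "set w \<subseteq> {1..K}" "legal R \<delta> lo tz w" "counter \<delta> w 0 = pc []"
        "\<forall>j<max r 1. counter \<delta> w (Suc j) = int (s j)"
      using exec_imp_steps by blast
    then show "\<exists>w. set w \<subseteq> {1..K} \<and> legal R \<delta> lo tz w \<and> counter \<delta> w 0 = pc [] \<and>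
        counter \<delta> w 1 = int (s 0)"
      by (intro exI[of _ w]) auto
  next
    fix w
    assume legal: "legal R \<delta> lo tz w" and halted: "counter \<delta> w 0 = pc []"
    from legal have "\<exists>u s. u \<in> ?X \<and> step\<^sup>*\<^sup>* ([p], \<lambda>_. 0) (u, s) \<and> counter \<delta> w 0 = pc u \<and>
        (\<forall>j<max r 1. counter \<delta> w (Suc j) = int (s j))"
    proof (induction w rule: rev_induct)
      case Nil
      show ?case using start by (intro exI[of _ "[p]"] exI[of _ "\<lambda>_. 0"]) (simp add: pc_def)
    next
      case (snoc k w)
      then obtain u s where u: "u \<in> ?X" "step\<^sup>*\<^sup>* ([p], \<lambda>_. 0) (u, s)" "counter \<delta> w 0 = pc u"
        "\<forall>j<max r 1. counter \<delta> w (Suc j) = int (s j)" by auto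
      show ?case
      proof (cases "k \<in> {1..length ts}")
        case True
        obtain x a y where t: "ts ! (k - 1) = (x, a, y)" by (cases "ts ! (k - 1)")
        have "u = x \<and> (\<exists>s'. act a s s')"
          using enabled[OF True t u(1), of "counter \<delta> w" s] u(3,4) snoc.prems by simp
        then obtain s' where s': "u = x" "act a s s'" by blast
        have xay: "(x, a, y) \<in> \<Delta>" using letter[OF True] t by simp
        then have "step (u, s) (y, s')" using s' by (auto simp: step_def \<Delta>_def)
        moreover have "counter \<delta> (w @ [k]) 0 = pc y"
          "\<forall>j<max r 1. counter \<delta> (w @ [k]) (Suc j) = int (s' j)"
          using u(3,4) s' act_delta[OF s'(2)] True t by (auto simp: \<delta>_def)
        ultimately show ?thesis using u(2) in_\<Delta>[OF xay] by (meson rtranclp.rtrancl_into_rtrancl)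
      next
        case False
        \<comment> \<open>A letter that is no transition leaves all counters unchanged, so the
          configuration reached before it still matches.\<close>
        then have "\<delta> k j = 0" for j by (auto simp: \<delta>_def)
        then show ?thesis using u by (intro exI[of _ u] exI[of _ s]) auto
      qed
    qed
    then obtain u s where u: "u \<in> ?X" "step\<^sup>*\<^sup>* ([p], \<lambda>_. 0) (u, s)" "counter \<delta> w 0 = pc u"
      "\<forall>j<max r 1. counter \<delta> w (Suc j) = int (s j)" by auto
    with halted have "u = []" using pc_eq[of u "[]"] by auto
    with u steps_imp_exec have "exec p (\<lambda>_. 0) s" by blast
    moreover have "counter \<delta> w 1 = int (s 0)" using u(4) by auto
    ultimately show "\<exists>s. exec p (\<lambda>_. 0) s \<and> counter \<delta> w 1 = int (s 0)" by blast
  qed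
qed

section \<open>Exact computations with integers\<close>

text \<open>In this range saturation does not act, and without fractional bits the grid consists of
  integers, so rounding up is the ceiling. This is what turns every weight \<open>1 / m\<close> into
  1.\<close>

lemma fwa_round_integers:
  fixes r :: rat
  assumes "- (2 ^ (p - 1)) \<le> r" "r \<le> 2 ^ (p - 1) - 1"
  shows "fwa_round Fixed_Point p 0 Saturate Round_Up r = of_int \<lceil>r\<rceil>"
proof -
  define B :: int where "B = 2 ^ (p - 1)"
  define V where "V = fwa_values Fixed_Point p 0"
  have V: "V = rat_of_int ` {- B..<B}"
    by (auto simp: V_def B_def)
  have fin: "finite V" by (simp add: V)
  have "0 < B" by (simp add: B_def)
  have r: "- of_int B \<le> r" "r \<le> of_int (B - 1)" using assms by (simp_all add: B_def)
  have "Min V = of_int (- B)"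
    using \<open>0 < B\<close> fin by (intro Min_eqI) (auto simp: V intro: image_eqI[of _ _ "- B"])
  moreover have "Max V = of_int (B - 1)"
    using \<open>0 < B\<close> fin by (intro Max_eqI) (auto simp: V simp flip: of_int_diff intro: image_eqI[of _ _ "B - 1"])
  ultimately have clip: "max (Min V) (min (Max V) r) = r"
    using r by simp
  have "Min {x \<in> V. r \<le> x} = of_int \<lceil>r\<rceil>"
  proof (intro Min_eqI)
    have "- B \<le> \<lceil>r\<rceil>" "\<lceil>r\<rceil> < B"
      using r \<open>0 < B\<close> by (simp_all add: le_ceiling_iff ceiling_less_iff)
    then show "of_int \<lceil>r\<rceil> \<in> {x \<in> V. r \<le> x}" by (auto simp: V)
  qed (use fin in \<open>auto simp: V ceiling_le_iff\<close>)
  then show ?thesis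
    unfolding fwa_round_def Let_def round_within_def V_def[symmetric]
    by (simp only: overflow.case rounding.case clip)
qed

abbreviation ivec :: "int list \<Rightarrow> vec" where
  "ivec \<equiv> map of_int"

definition dot :: "int list \<Rightarrow> int list \<Rightarrow> int" where
  "dot u v = sum_list (map2 (*) u v)"

type_synonym int_layer = "(int list \<times> int) list"

definition rat_fnn :: "int_layer list \<Rightarrow> fnn" where
  "rat_fnn = map (map (\<lambda>(w, b). (ivec w, of_int b)))"

definition affine :: "int_layer \<Rightarrow> int list \<Rightarrow> int list" where
  "affine l x = map (\<lambda>(w, b). dot w x + b) l"

fun int_fnn :: "int_layer list \<Rightarrow> int list \<Rightarrow> int list" where
  "int_fnn [] x = x"
| "int_fnn [l] x = affine l x"
| "int_fnn (l # l' # ls) x = int_fnn (l' # ls) (map (max 0) (affine l x))"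

lemma sum_abs_le: "(\<And>z. z \<in> set zs \<Longrightarrow> \<bar>z\<bar> \<le> D) \<Longrightarrow> (\<Sum>z\<leftarrow>zs. \<bar>z\<bar>) \<le> int (length zs) * (D :: int)"
  by (induction zs) (auto simp: algebra_simps add_mono)

text \<open>
  Since the weight \<open>1 / m\<close> of hardmax is rounded up to \<open>1\<close>, an attention head computes the sum, not
  the average, over the positions of maximal score.
\<close>

locale integer_arithmetic =
  fixes rnd :: "rat \<Rightarrow> rat" and M :: int and T :: nat
  assumes M: "2 \<le> M"
    and rnd_int: "\<bar>z\<bar> \<le> M ^ T \<Longrightarrow> rnd (of_int z) = of_int z"
    and rnd_inverse: "0 < m \<Longrightarrow> rnd (1 / of_nat m) = 1"
begin

text \<open>Sizes are measured in exponents of \<open>M\<close>. A product adds exponents, and a sum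
  of at most \<open>M\<close> terms costs one more, so the absence of rounding errors reduces to
  linear inequalities with \<open>T\<close>.\<close>

definition bdd :: "nat \<Rightarrow> int list \<Rightarrow> bool" where
  "bdd t v \<longleftrightarrow> (\<forall>x \<in> set v. \<bar>x\<bar> \<le> M ^ t)"

lemma power_le: "s \<le> t \<Longrightarrow> M ^ s \<le> M ^ t"
  using M by (intro power_increasing) auto

lemma bdd_mono: "bdd s v \<Longrightarrow> s \<le> t \<Longrightarrow> bdd t v"
  using power_le by (fastforce simp: bdd_def)

lemma map_rnd: "bdd t v \<Longrightarrow> t \<le> T \<Longrightarrow> map rnd (ivec v) = ivec v"
  using bdd_mono[of t v T] by (auto simp: bdd_def rnd_int)

lemma rnd_zero [simp]: "rnd 0 = 0" and rnd_one [simp]: "rnd 1 = 1"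
  using rnd_int[of 0] rnd_int[of 1] M by auto

text \<open>The sum of the absolute values bounds every partial sum, so no rounding during the
  evaluation from left to right changes anything.\<close>

lemma foldl_exact:
  "\<bar>a\<bar> + (\<Sum>z\<leftarrow>zs. \<bar>z\<bar>) \<le> M ^ T \<Longrightarrow>
     foldl (\<lambda>s x. rnd (s + x)) (of_int a) (ivec zs) = of_int (a + sum_list zs)"
proof (induction zs arbitrary: a)
  case (Cons z zs)
  have "0 \<le> (\<Sum>z\<leftarrow>zs. \<bar>z\<bar>)" by (rule sum_list_nonneg) auto
  then have "rnd (of_int a + of_int z) = of_int (a + z)"
    using rnd_int[of "a + z"] Cons.prems by simp
  moreover have "\<bar>a + z\<bar> + (\<Sum>z\<leftarrow>zs. \<bar>z\<bar>) \<le> M ^ T" using Cons.prems by simp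
  ultimately show ?case using Cons.IH[of "a + z"] by (simp add: add.assoc)
qed simp

lemma inner_exact:
  assumes "bdd s u" "bdd t v" "int (length u) \<le> M" "s + t + 1 \<le> T"
  shows "inner_in rnd (ivec u) (ivec v) = of_int (dot u v)"
    and "\<bar>dot u v\<bar> \<le> M ^ (s + t + 1)"
proof -
  let ?ps = "map2 (*) u v"
  have ps: "\<bar>z\<bar> \<le> M ^ (s + t)" if "z \<in> set ?ps" for z
  proof -
    from that obtain a b where "a \<in> set u" "b \<in> set v" "z = a * b"
      by (auto dest: set_zip_leftD set_zip_rightD)
    then show ?thesis
      using assms(1,2) mult_mono[of "\<bar>a\<bar>" "M ^ s" "\<bar>b\<bar>" "M ^ t"] M
      by (auto simp: bdd_def abs_mult power_add)
  qed
  have "(\<Sum>z\<leftarrow>?ps. \<bar>z\<bar>) \<le> int (length ?ps) * M ^ (s + t)"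
    by (rule sum_abs_le) (use ps in blast)
  also have "\<dots> \<le> M * M ^ (s + t)"
    using assms(3) M by (intro mult_right_mono) auto
  finally have sum: "(\<Sum>z\<leftarrow>?ps. \<bar>z\<bar>) \<le> M ^ (s + t + 1)" by simp
  have "\<bar>sum_list zs\<bar> \<le> (\<Sum>z\<leftarrow>zs. \<bar>z\<bar>)" for zs :: "int list"
    by (induction zs) auto
  from this[of ?ps] sum show "\<bar>dot u v\<bar> \<le> M ^ (s + t + 1)" unfolding dot_def by linarith
  have "map2 (\<lambda>a b. rnd (a * b)) (ivec u) (ivec v) = ivec ?ps"
  proof -
    have "rnd (of_int a * of_int b) = of_int (a * b)" if "(a, b) \<in> set (zip u v)" for a b
    proof -
      have "\<bar>a * b\<bar> \<le> M ^ (s + t)" using that by (intro ps) force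
      also have "\<dots> \<le> M ^ T" using assms(4) by (intro power_le) simp
      finally show ?thesis using rnd_int[of "a * b"] by simp
    qed
    then show ?thesis by (auto simp: zip_map_map)
  qed
  moreover have "(\<Sum>z\<leftarrow>?ps. \<bar>z\<bar>) \<le> M ^ T"
    using sum power_le[OF assms(4)] by linarith
  ultimately show "inner_in rnd (ivec u) (ivec v) = of_int (dot u v)"
    using foldl_exact[of 0 ?ps] by (simp add: inner_in_def sum_in_def dot_def)
qed

definition matrix_ok :: "int list list \<Rightarrow> bool" where
  "matrix_ok W \<longleftrightarrow> (\<forall>r \<in> set W. bdd 1 r \<and> int (length r) \<le> M)"

lemma apply_matrix_exact:
  assumes "matrix_ok W" "bdd t x" "t + 2 \<le> T"
  shows "apply_matrix rnd (map ivec W) (ivec x) = ivec (map (\<lambda>r. dot r x) W)"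
    and "bdd (t + 2) (map (\<lambda>r. dot r x) W)"
proof -
  have "inner_in rnd (map rnd (ivec r)) (ivec x) = of_int (dot r x) \<and> \<bar>dot r x\<bar> \<le> M ^ (t + 2)"
    if "r \<in> set W" for r
  proof -
    have r: "bdd 1 r" "int (length r) \<le> M" using that assms(1) by (auto simp: matrix_ok_def)
    have "map rnd (ivec r) = ivec r" using map_rnd[OF r(1)] assms(3) by simp
    with inner_exact[OF r(1) assms(2) r(2)] assms(3) show ?thesis by (simp del: map_map)
  qed
  then show "apply_matrix rnd (map ivec W) (ivec x) = ivec (map (\<lambda>r. dot r x) W)"
    and "bdd (t + 2) (map (\<lambda>r. dot r x) W)"
    by (auto simp: apply_matrix_def bdd_def)
qed

definition layer_ok :: "int_layer \<Rightarrow> bool" where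
  "layer_ok l \<longleftrightarrow> (\<forall>(w, b) \<in> set l. bdd 1 w \<and> int (length w) \<le> M \<and> \<bar>b\<bar> \<le> M)"

lemma affine_exact:
  assumes "layer_ok l" "bdd t x" "t + 3 \<le> T"
  shows "apply_affine rnd (map (\<lambda>(w, b). (ivec w, of_int b)) l) (ivec x) = ivec (affine l x)"
    and "bdd (t + 3) (affine l x)"
proof -
  have neuron: "rnd (inner_in rnd (map rnd (ivec w)) (ivec x) + rnd (of_int b)) = of_int (dot w x + b) \<and>
      \<bar>dot w x + b\<bar> \<le> M ^ (t + 3)" if "(w, b) \<in> set l" for w b
  proof -
    have wb: "bdd 1 w" "int (length w) \<le> M" "\<bar>b\<bar> \<le> M" using that assms(1) by (auto simp: layer_ok_def)
    have dot: "inner_in rnd (map rnd (ivec w)) (ivec x) = of_int (dot w x)" "\<bar>dot w x\<bar> \<le> M ^ (t + 2)"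
    proof -
      have "map rnd (ivec w) = ivec w" using map_rnd[OF wb(1)] assms(3) by simp
      with inner_exact[OF wb(1) assms(2) wb(2)] assms(3)
      show "inner_in rnd (map rnd (ivec w)) (ivec x) = of_int (dot w x)" "\<bar>dot w x\<bar> \<le> M ^ (t + 2)"
        by (simp_all del: map_map)
    qed
    have "M \<le> M ^ (t + 2)" "M \<le> M ^ T" using power_le[of 1 "t + 2"] power_le[of 1 T] assms(3) by auto
    have "\<bar>dot w x + b\<bar> \<le> M ^ (t + 2) + M ^ (t + 2)" using dot(2) wb(3) \<open>M \<le> M ^ (t + 2)\<close> by linarith
    \<comment> \<open>The bias at most doubles the bound, which \<open>2 \<le> M\<close> absorbs
      into one more factor. A layer thus costs three exponents: weights, row length and
      bias.\<close>
    also have "\<dots> \<le> M * M ^ (t + 2)" using M mult_right_mono[of 2 M "M ^ (t + 2)"] by simp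
    finally have bound: "\<bar>dot w x + b\<bar> \<le> M ^ (t + 3)" by (simp add: numeral_3_eq_3)
    moreover have "M ^ (t + 3) \<le> M ^ T" using assms(3) by (rule power_le)
    ultimately have "rnd (of_int (dot w x + b)) = of_int (dot w x + b)" by (intro rnd_int) linarith
    moreover have "rnd (of_int b) = of_int b" using wb(3) \<open>M \<le> M ^ T\<close> by (intro rnd_int) linarith
    ultimately show ?thesis using dot(1) bound by simp
  qed
  then show "apply_affine rnd (map (\<lambda>(w, b). (ivec w, of_int b)) l) (ivec x) = ivec (affine l x)"
    by (auto simp: apply_affine_def affine_def)
  show "bdd (t + 3) (affine l x)" using neuron by (auto simp: affine_def bdd_def)
qed

lemma fnn_exact:
  assumes "\<And>l. l \<in> set N \<Longrightarrow> layer_ok l" "bdd t x" "t + 3 * length N \<le> T"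
  shows "apply_fnn rnd (rat_fnn N) (ivec x) = ivec (int_fnn N x)"
    and "bdd (t + 3 * length N) (int_fnn N x)"
  using assms
proof (induction N x arbitrary: t rule: int_fnn.induct)
  case (3 l l' ls x)
  have relu: "map relu (ivec (affine l x)) = ivec (map (max 0) (affine l x))"
    by (auto simp: relu_def max_def)
  have b: "bdd (t + 3) (map (max 0) (affine l x))" if "bdd (t + 3) (affine l x)" for t
    using that M by (auto simp: bdd_def max_def)
  {
    case 1
    then have "layer_ok l" "t + 3 \<le> T" by simp_all
    note l = affine_exact[OF this(1) 1(2) this(2)]
    show ?case using "3.IH"(1)[of "t + 3"] b[OF l(2)] l(1) relu 1 by (simp add: rat_fnn_def del: map_map)
  next
    case 2
    then have "layer_ok l" "t + 3 \<le> T" by simp_all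
    note l = affine_exact[OF this(1) 2(2) this(2)]
    show ?case using "3.IH"(2)[of "t + 3"] b[OF l(2)] 2 by (simp add: algebra_simps)
  }
qed (simp_all add: affine_exact rat_fnn_def)

text \<open>The entries \<open>dot r (X i)\<close> have exponent \<open>t + 2\<close>; adding them
  up over at most \<open>M\<close> positions costs one more.\<close>

lemma pool_exact:
  assumes h: "value_matrix h = map ivec W" "matrix_ok W"
    and X: "\<And>i. i < n \<Longrightarrow> bdd t (X i)" "int n \<le> M" "t + 3 \<le> T" and s: "length s = n"
  shows "pool_in rnd h (map (\<lambda>i. ivec (X i)) [0..<n]) s =
      ivec (map (\<lambda>r. \<Sum>i | i < n \<and> (\<forall>j<n. s ! j \<le> s ! i). dot r (X i)) W)"
proof -
  let ?I = "{i. i < n \<and> (\<forall>j<n. s ! j \<le> s ! i)}"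
  define u where "u i r = (if i \<in> ?I then dot r (X i) else 0)" for i r
  have bound: "\<bar>dot r (X i)\<bar> \<le> M ^ (t + 2)" if "i < n" "r \<in> set W" for i r
    using apply_matrix_exact(2)[OF h(2) X(1)[OF that(1)]] X(3) that(2) by (auto simp: bdd_def)
  then have u_bound: "\<bar>u i r\<bar> \<le> M ^ (t + 2)" if "i < n" "r \<in> set W" for i r
    using that M by (auto simp: u_def)
  have weights: "rnd (hardmax i s) = (if i \<in> ?I then 1 else 0)" if "i < n" for i
  proof -
    have "0 < card {j. j < length s \<and> s ! j = s ! i}"
      using that s by (intro card_gt_0_iff[THEN iffD2]) auto
    then show ?thesis using that s by (auto simp: hardmax_def rnd_inverse)
  qed
  have row: "map (\<lambda>y. rnd (rnd (hardmax i s) * y))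
      (apply_matrix rnd (value_matrix h) (map (\<lambda>i. ivec (X i)) [0..<n] ! i)) = ivec (map (u i) W)"
    if "i < n" for i
  proof -
    have "rnd (of_int (u i r)) = of_int (u i r)" if "r \<in> set W" for r
      using u_bound[OF \<open>i < n\<close> that] power_le[of "t + 2" T] X(3) by (intro rnd_int) linarith
    then show ?thesis
      using that apply_matrix_exact(1)[OF h(2) X(1)[OF that]] X(3) weights[OF that]
      by (auto simp: h(1) u_def)
  qed
  have fold: "foldl (map2 (\<lambda>a b. rnd (a + b))) (replicate (length W) 0) (map (\<lambda>i. ivec (map (u i) W)) [0..<k]) =
      ivec (map (\<lambda>r. \<Sum>i<k. u i r) W)" if "k \<le> n" for k
    using that
  proof (induction k)
    case 0
    show ?case by (simp add: map_replicate_const)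
  next
    case (Suc k)
    have "rnd (of_int (\<Sum>i<k. u i r) + of_int (u k r)) = of_int (\<Sum>i<Suc k. u i r)" if "r \<in> set W" for r
    proof -
      have "\<bar>\<Sum>i<Suc k. u i r\<bar> \<le> (\<Sum>i<Suc k. M ^ (t + 2))"
        using Suc.prems u_bound that by (intro order_trans[OF sum_abs] sum_mono) auto
      also have "\<dots> \<le> M * M ^ (t + 2)"
        using Suc.prems X(2) M by (simp only: sum_constant card_lessThan, intro mult_right_mono) auto
      also have "\<dots> = M ^ (t + 3)" by (simp add: numeral_3_eq_3)
      also have "\<dots> \<le> M ^ T" using X(3) by (rule power_le)
      finally show ?thesis using rnd_int[of "\<Sum>i<Suc k. u i r"] by simp
    qed
    then show ?case using Suc by (simp add: zip_map_map zip_same_conv_map)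
  qed
  have "pool_in rnd h (map (\<lambda>i. ivec (X i)) [0..<n]) s =
      foldl (map2 (\<lambda>a b. rnd (a + b))) (replicate (length W) 0) (map (\<lambda>i. ivec (map (u i) W)) [0..<n])"
  proof -
    have "map (\<lambda>i. map (\<lambda>y. rnd (rnd (hardmax i s) * y))
        (apply_matrix rnd (value_matrix h) (map (\<lambda>i. ivec (X i)) [0..<n] ! i))) [0..<n] =
        map (\<lambda>i. ivec (map (u i) W)) [0..<n]"
      by (intro map_cong refl row) simp
    then show ?thesis
      unfolding pool_in_def by (simp only: h(1) length_map length_upt minus_nat.diff_0)
  qed
  also have "\<dots> = ivec (map (\<lambda>r. \<Sum>i<n. u i r) W)" by (rule fold) simp
  also have "(\<lambda>r. \<Sum>i<n. u i r) = (\<lambda>r. \<Sum>i\<in>?I. dot r (X i))"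
    by (rule ext, rule sum.mono_neutral_cong_right) (auto simp: u_def)
  finally show ?thesis .
qed

end

section \<open>An encoder that checks runs of a counter system\<close>

lemma dot_append: "length a = length c \<Longrightarrow> dot (a @ b) (c @ d) = dot a c + dot b d"
  by (simp add: dot_def)

lemma dot_map: "dot (map f [0..<n]) (map g [0..<n]) = (\<Sum>l<n. f l * g l)"
  by (simp add: dot_def map2_map_map zip_map_map zip_same_conv_map interv_sum_list_conv_sum_set_nat
      atLeast0LessThan)

lemma dot_Nil [simp]: "dot [] v = 0" and dot_Cons [simp]: "dot (a # u) (b # v) = a * b + dot u v"
  by (simp_all add: dot_def)

definition unit_row :: "nat \<Rightarrow> nat \<Rightarrow> int" where
  "unit_row j l = (if l = j then 1 else 0)"

lemma sum_unit_row:
  assumes "j < n"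
  shows "(\<Sum>l<n. unit_row j l * g l) = g j" "(\<Sum>l<n. - unit_row j l * g l) = - g j"
  using assms by (simp_all add: unit_row_def if_distrib[of "\<lambda>a. a * _"] sum.delta' sum_negf cong: if_cong)

text \<open>A function on the letters is the combination of the ramps \<open>max 0 (k - t)\<close> whose
  coefficients are its second differences.\<close>

definition second_difference :: "(nat \<Rightarrow> int) \<Rightarrow> nat \<Rightarrow> int" where
  "second_difference f t = f (Suc t) - 2 * f t + f (t - 1)"

text \<open>Summation by parts: as \<open>f 0 = 0\<close>, the partial sums of the second
  differences are first differences, and these add up to \<open>f\<close>. At \<open>t = 0\<close>
  the truncated \<open>t - 1\<close> stands for the value 0 at -1. From \<open>t = K + 2\<close> on
  all three values vanish, hence \<open>K + 2\<close> ramps.\<close>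

lemma sum_ramps:
  assumes "\<And>k. k \<notin> {1..K} \<Longrightarrow> f k = 0"
  shows "(\<Sum>t<K + 2. second_difference f t * max 0 (int k - int t)) = f k"
proof -
  have first: "(\<Sum>t<Suc m. second_difference f t) = f (Suc m) - f m" for m
    using assms[of 0] by (induction m) (auto simp: second_difference_def)
  have "(\<Sum>t<m. second_difference f t * (int m - int t)) = f m" for m
  proof (induction m)
    case 0
    show ?case using assms[of 0] by simp
  next
    case (Suc m)
    have "(\<Sum>t<Suc m. second_difference f t * (int (Suc m) - int t)) =
        (\<Sum>t<Suc m. second_difference f t * (int m - int t)) + (\<Sum>t<Suc m. second_difference f t)"
      by (simp only: sum.distrib[symmetric]) (simp add: algebra_simps)
    also have "\<dots> = f (Suc m)" using Suc first by simp
    finally show ?case .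
  qed
  moreover have "(\<Sum>t<K + 2. second_difference f t * max 0 (int k - int t)) =
      (\<Sum>t<k. second_difference f t * (int k - int t))"
  proof (rule sum.mono_neutral_cong)
    fix t
    assume "t \<in> {..<k} - {..<K + 2}"
    then show "second_difference f t * (int k - int t) = 0"
      using assms by (cases t) (auto simp: second_difference_def)
  qed auto
  ultimately show ?thesis by simp
qed

text \<open>For \<open>z = 0\<close> this is \<open>max 0 (l - c)\<close>; for \<open>z = 1\<close>
  it is \<open>l - c\<close> below \<open>l\<close>, 0 at \<open>l\<close> and 1 above. As a linear
  combination of ReLU terms it needs a single hidden layer.\<close>

definition violation :: "int \<Rightarrow> int \<Rightarrow> int \<Rightarrow> int" where
  "violation c l z = 2 * max 0 (l - c) - max 0 (z - (c - l)) + max 0 z"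

lemma violation:
  assumes "z = 0 \<or> z = 1"
  shows "0 \<le> violation c l z" "violation c l z = 0 \<longleftrightarrow> allowed c l z"
  using assms by (auto simp: violation_def allowed_def max_def)

definition rat_matrix :: "int list list \<Rightarrow> matrix" where
  "rat_matrix = map ivec"

text \<open>The argument will be the key position minus the query position. All positions up to the
  current one then share the maximal score 0.\<close>

definition prefix_score :: "int_layer list" where
  "prefix_score = [[([1], 0)], [([- 1], 0)]]"

text \<open>Matrices without rows make every inner product 0, so all scores tie and the head ranges
  over the whole word.\<close>

definition sum_head :: head_desc where
  "sum_head = \<lparr>query_matrix = [], key_matrix = [], score_net = rat_fnn [[([1], 0)]],
     value_matrix = rat_matrix [[1, 0, 0]]\<rparr>"

definition sum_comb :: "int_layer list" where
  "sum_comb = [[([0, 1, 0, 1], 0), ([0, 0, 1, 0], 0)]]"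

definition sum_layer :: layer_desc where
  "sum_layer = \<lparr>head_descs = [sum_head], comb_net = rat_fnn sum_comb\<rparr>"

text \<open>The value is \<open>1 - \<bar>v - x\<bar> - s\<close>. The constant occurs once, as a
  nonnegative bias of a neuron with zero weights; so the code of the network is easily computed from
  \<open>x\<close>, and the next layer forms both signs of \<open>v - x\<close>.\<close>

definition output_net :: "nat \<Rightarrow> int_layer list" where
  "output_net x =
     [[([1, 0], 0), ([0, 1], 0), ([0, 0], int x)], [([0, 1, - 1], 0), ([0, - 1, 1], 0), ([1, 0, 0], 0)],
      [([- 1, - 1, - 1], 1)]]"

lemma int_fnn_output:
  assumes "0 \<le> s" "0 \<le> v"
  shows "int_fnn (output_net x) [s, v] = [1 - \<bar>v - int x\<bar> - s]"
  using assms by (simp add: output_net_def affine_def)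

section \<open>The layers as maps on integer vectors\<close>

context counter_system
begin

definition block :: "(nat \<Rightarrow> int) \<Rightarrow> int list" where
  "block f = map f [0..<R]"

lemma length_block [simp]: "length (block f) = R"
  by (simp add: block_def)

lemma dot_block: "dot (block f) (block g) = (\<Sum>l<R. f l * g l)"
  by (simp add: block_def dot_map)

definition ramp_row :: "(nat \<Rightarrow> int) \<Rightarrow> int list \<times> int" where
  "ramp_row f = (map (second_difference f) [0..<K + 2] @ [0], 0)"

text \<open>The hidden layer consists of the ramps of the letter index and of the position, which
  ReLU leaves unchanged. The output starts with a constant 1, from which queries and keys take their
  constant entries.\<close>

definition feature_net :: "int_layer list" where
  "feature_net =
     [map (\<lambda>t. ([0, 0, 0, 0, 1], - int t)) [0..<K + 2] @ [([0, 0, 1, 0, 0], 0)],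
      [(map (\<lambda>_. 0) [0..<K + 2] @ [0], 1), (map (\<lambda>_. 0) [0..<K + 2] @ [1], 0)] @
      map (\<lambda>j. ramp_row (\<lambda>k. \<delta> k j)) [0..<R] @
      map (\<lambda>j. ramp_row (\<lambda>k. lo k j)) [0..<R] @
      map (\<lambda>j. ramp_row (\<lambda>k. tz k j)) [0..<R]]"

definition features :: "nat \<Rightarrow> nat \<Rightarrow> int list" where
  "features i k = [1, int i] @ block (\<delta> k) @ block (lo k) @ block (tz k)"

lemma int_fnn_feature_net: "int_fnn feature_net [0, 1, int i, s, int k] = features i k"
proof -
  let ?x = "map (\<lambda>t. max 0 (int k - int t)) [0..<K + 2] @ [int i]"
  have hidden: "map (max 0) (affine (map (\<lambda>t. ([0, 0, 0, 0, 1], - int t)) [0..<K + 2] @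
      [([0, 0, 1, 0, 0], 0)]) [0, 1, int i, s, int k]) = ?x"
    by (simp add: affine_def)
  have const: "dot (map (\<lambda>_. 0) [0..<K + 2] @ [a]) ?x = a * int i" for a
    by (simp only: dot_append length_map dot_map) simp
  have ramp: "dot (fst (ramp_row f)) ?x + snd (ramp_row f) = f k"
    if "\<And>k. k \<notin> {1..K} \<Longrightarrow> f k = 0" for f
    using sum_ramps[OF that] by (simp only: ramp_row_def fst_conv snd_conv dot_append length_map dot_map) simp
  have blocks: "affine (map (\<lambda>j. ramp_row (\<lambda>k. g k j)) [0..<R]) ?x = block (g k)"
    if "\<And>k j. k \<notin> {1..K} \<Longrightarrow> g k j = 0" for g :: "nat \<Rightarrow> nat \<Rightarrow> int"
    using ramp[of "\<lambda>k. g k _"] that by (simp add: affine_def block_def case_prod_beta comp_def)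
  have app: "affine (l @ l') y = affine l y @ affine l' y" for l l' y
    by (simp add: affine_def)
  have "int_fnn feature_net [0, 1, int i, s, int k] = [1, int i] @
      affine (map (\<lambda>j. ramp_row (\<lambda>k. \<delta> k j)) [0..<R]) ?x @
      affine (map (\<lambda>j. ramp_row (\<lambda>k. lo k j)) [0..<R]) ?x @
      affine (map (\<lambda>j. ramp_row (\<lambda>k. tz k j)) [0..<R]) ?x"
  proof -
    have "affine [(map (\<lambda>_. 0) [0..<K + 2] @ [0], 1), (map (\<lambda>_. 0) [0..<K + 2] @ [1], 0)] ?x = [1, int i]"
      by (simp only: affine_def list.map prod.case const) simp
    then show ?thesis
      by (simp only: feature_net_def int_fnn.simps hidden) (simp only: app)
  qed
  also have "affine (map (\<lambda>j. ramp_row (\<lambda>k. \<delta> k j)) [0..<R]) ?x = block (\<delta> k)"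
    by (rule blocks) (rule features_outside)
  also have "affine (map (\<lambda>j. ramp_row (\<lambda>k. lo k j)) [0..<R]) ?x = block (lo k)"
    by (rule blocks) (rule features_outside)
  also have "affine (map (\<lambda>j. ramp_row (\<lambda>k. tz k j)) [0..<R]) ?x = block (tz k)"
    by (rule blocks) (rule features_outside)
  finally show ?thesis unfolding features_def .
qed

definition feature_layer :: layer_desc where
  "feature_layer = \<lparr>head_descs = [], comb_net = rat_fnn feature_net\<rparr>"

definition row :: "int \<Rightarrow> int \<Rightarrow> (nat \<Rightarrow> int) \<Rightarrow> (nat \<Rightarrow> int) \<Rightarrow> (nat \<Rightarrow> int) \<Rightarrow> int list" where
  "row a b f g h = [a, b] @ block f @ block g @ block h"

lemma dot_row:
  "dot (row a b f g h) (features i k) = a + b * int i + (\<Sum>l<R. f l * \<delta> k l) + (\<Sum>l<R. g l * lo k l) +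
     (\<Sum>l<R. h l * tz k l)"
  by (simp add: row_def features_def dot_append dot_block)

abbreviation (input) zero :: "nat \<Rightarrow> int" where
  "zero \<equiv> \<lambda>_. 0"

text \<open>The query \<open>(1, m)\<close> and the key \<open>(i, - 1)\<close> have inner product
  \<open>i - m\<close>, so a bilinear form compares two positions.\<close>

definition prefix_head :: head_desc where
  "prefix_head =
     \<lparr>query_matrix = rat_matrix [row 1 0 zero zero zero, row 0 1 zero zero zero],
      key_matrix = rat_matrix [row 0 1 zero zero zero, row (- 1) 0 zero zero zero],
      score_net = rat_fnn prefix_score,
      value_matrix = rat_matrix (map (\<lambda>j. row 0 0 (unit_row j) zero zero) [0..<R])\<rparr>"

text \<open>Some position always has maximal score, so the prefix includes the current letter and
  the head value \<open>c\<close> is the counter after it. The guards concern the value before,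
  \<open>c j - \<delta> k j\<close>, whereas the halting test and the result need \<open>c\<close>
  itself at the last position.\<close>

definition check_net :: "int_layer list" where
  "check_net =
     [map (\<lambda>j. (row 0 0 (unit_row j) (unit_row j) zero @ block (\<lambda>l. - unit_row j l), 0)) [0..<R] @
      map (\<lambda>j. (row 0 0 (unit_row j) (unit_row j) (unit_row j) @ block (\<lambda>l. - unit_row j l), 0)) [0..<R] @
      map (\<lambda>j. (row 0 0 zero zero (unit_row j) @ block zero, 0)) [0..<R] @
      [(row 0 0 zero zero zero @ block (unit_row 0), - hlt), (row 0 0 zero zero zero @ block (\<lambda>l. - unit_row 0 l), hlt),
       (row 0 0 zero zero zero @ block (unit_row 1), 0)],
      [(block (\<lambda>_. 2) @ block (\<lambda>_. - 1) @ block (\<lambda>_. 1) @ [0, 0, 0], 0),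
       (block zero @ block zero @ block zero @ [1, 1, 0], 0),
       (block zero @ block zero @ block zero @ [0, 0, 1], 0)]]"

definition check_layer :: layer_desc where
  "check_layer = \<lparr>head_descs = [prefix_head], comb_net = rat_fnn check_net\<rparr>"

lemma int_fnn_check_net:
  "int_fnn check_net (features i k @ block c) =
     [\<Sum>j<R. violation (c j - \<delta> k j) (lo k j) (tz k j), \<bar>c 0 - hlt\<bar>, max 0 (c 1)]"
proof -
  let ?x = "features i k @ block c"
  let ?y = "block (\<lambda>j. max 0 (lo k j - (c j - \<delta> k j))) @ block (\<lambda>j. max 0 (tz k j - (c j - \<delta> k j - lo k j))) @
    block (\<lambda>j. max 0 (tz k j)) @ [max 0 (c 0 - hlt), max 0 (hlt - c 0), max 0 (c 1)]"
  have len: "length (row a b f g h) = length (features i k)" for a b f g h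
    by (simp add: row_def features_def)
  have dot: "dot (row 0 0 f g h @ block e) ?x =
      (\<Sum>l<R. f l * \<delta> k l) + (\<Sum>l<R. g l * lo k l) + (\<Sum>l<R. h l * tz k l) + (\<Sum>l<R. e l * c l)" for f g h e
    by (simp add: dot_append[OF len] dot_row dot_block)
  have hidden: "map (max 0) (affine (hd check_net) ?x) = ?y"
  proof -
    have layer: "map (max 0) (affine (map (\<lambda>j. (r j, 0)) [0..<R]) ?x) = block g"
      if "\<And>j. j < R \<Longrightarrow> max 0 (dot (r j) ?x) = g j" for r g
      using that by (simp add: affine_def block_def)
    have "map (max 0) (affine (map (\<lambda>j. (row 0 0 (unit_row j) (unit_row j) zero @
        block (\<lambda>l. - unit_row j l), 0)) [0..<R]) ?x) = block (\<lambda>j. max 0 (lo k j - (c j - \<delta> k j)))"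
      by (rule layer) (simp add: dot sum_unit_row del: mult_minus_left; simp add: algebra_simps)
    moreover have "map (max 0) (affine (map (\<lambda>j. (row 0 0 (unit_row j) (unit_row j) (unit_row j) @
        block (\<lambda>l. - unit_row j l), 0)) [0..<R]) ?x) = block (\<lambda>j. max 0 (tz k j - (c j - \<delta> k j - lo k j)))"
      by (rule layer) (simp add: dot sum_unit_row del: mult_minus_left; simp add: algebra_simps)
    moreover have "map (max 0) (affine (map (\<lambda>j. (row 0 0 zero zero (unit_row j) @ block zero, 0)) [0..<R]) ?x) =
        block (\<lambda>j. max 0 (tz k j))"
      by (rule layer) (simp add: dot sum_unit_row)
    moreover have "affine (l @ l') y = affine l y @ affine l' y" for l l' y
      by (simp add: affine_def)
    ultimately show ?thesis
      using R by (simp add: check_net_def affine_def[of "[_, _, _]"] dot sum_unit_row del: mult_minus_left)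
  qed
  have "int_fnn check_net ?x = affine (check_net ! 1) ?y"
    using hidden by (simp add: check_net_def)
  also have "\<dots> = [\<Sum>j<R. violation (c j - \<delta> k j) (lo k j) (tz k j), \<bar>c 0 - hlt\<bar>, max 0 (c 1)]"
    by (simp add: check_net_def affine_def dot_append dot_block violation_def sum.distrib
        sum_subtractf sum_distrib_left sum_negf)
  finally show ?thesis .
qed

end

section \<open>Exact scores and head values\<close>

context integer_arithmetic
begin

lemma score_exact:
  assumes h: "query_matrix h = map ivec Q" "key_matrix h = map ivec V" "score_net h = rat_fnn N"
    and ok: "matrix_ok Q" "matrix_ok V" "int (length Q) \<le> M" "\<And>l. l \<in> set N \<Longrightarrow> layer_ok l"
    and xy: "bdd t x" "bdd t y" and T: "2 * t + 5 + 3 * length N \<le> T"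
    and eval: "int_fnn N [dot (map (\<lambda>r. dot r x) Q) (map (\<lambda>r. dot r y) V)] = [z]"
  shows "score_in rnd h (ivec x) (ivec y) = of_int z"
proof -
  let ?u = "map (\<lambda>r. dot r x) Q" and ?v = "map (\<lambda>r. dot r y) V"
  have u: "apply_matrix rnd (query_matrix h) (ivec x) = ivec ?u" "bdd (t + 2) ?u"
    using apply_matrix_exact[OF ok(1) xy(1)] T h(1) by simp_all
  have v: "apply_matrix rnd (key_matrix h) (ivec y) = ivec ?v" "bdd (t + 2) ?v"
    using apply_matrix_exact[OF ok(2) xy(2)] T h(2) by simp_all
  have inner: "inner_in rnd (ivec ?u) (ivec ?v) = of_int (dot ?u ?v)" "\<bar>dot ?u ?v\<bar> \<le> M ^ (2 * t + 5)"
  proof -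
    have "t + 2 + (t + 2) + 1 = 2 * t + 5" by simp
    with inner_exact[OF u(2) v(2)] ok(3) T
    show "inner_in rnd (ivec ?u) (ivec ?v) = of_int (dot ?u ?v)" "\<bar>dot ?u ?v\<bar> \<le> M ^ (2 * t + 5)"
      by (simp_all only: length_map)
  qed
  have "bdd (2 * t + 5) [dot ?u ?v]" using inner(2) by (simp add: bdd_def)
  from fnn_exact(1)[OF ok(4) this T]
  have "apply_fnn rnd (score_net h) [of_int (dot ?u ?v)] = [of_int z]"
    using eval h(3) by simp
  then show ?thesis unfolding score_in_def u(1) v(1) inner(1) by simp
qed

lemma head_exact:
  assumes h: "value_matrix h = map ivec W" "matrix_ok W"
    and X: "\<And>i. i < n \<Longrightarrow> bdd t (X i)" "int n \<le> M" "t + 3 \<le> T"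
    and score: "\<And>i. i < n \<Longrightarrow> score_in rnd h (ivec x) (ivec (X i)) = of_int (z i)"
  shows "head_value (head_in rnd h) (map (\<lambda>i. ivec (X i)) [0..<n]) (ivec x) =
      ivec (map (\<lambda>r. \<Sum>i | i < n \<and> (\<forall>j<n. z j \<le> z i). dot r (X i)) W)"
proof -
  let ?s = "map (score_in rnd h (ivec x)) (map (\<lambda>i. ivec (X i)) [0..<n])"
  have "?s ! j \<le> ?s ! i \<longleftrightarrow> z j \<le> z i" if "i < n" "j < n" for i j
    using that score by simp
  then have "{i. i < n \<and> (\<forall>j<n. ?s ! j \<le> ?s ! i)} = {i. i < n \<and> (\<forall>j<n. z j \<le> z i)}"
    by blast
  then show ?thesis
    using pool_exact[where s = ?s, OF h X] by (simp add: head_value_def head_in_def del: map_map)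
qed

end

text \<open>The largest exponent occurs in the score of \<open>sum_head\<close>: vectors of exponent
  8 and a network of one layer give \<open>2 * 8 + 5 + 3 = 24\<close>, which 30 covers.\<close>

locale counter_system_encoder =
  counter_system K R \<delta> lo tz hlt + integer_arithmetic rnd M 30
  for K R \<delta> lo tz hlt rnd M +
  fixes w :: "nat list"
  assumes K: "int K + 3 \<le> M" and w: "int (length w) \<le> M" "\<And>k. k \<in> set w \<Longrightarrow> int k \<le> M"
begin

lemma M_ge: "13 \<le> M"
  using K R by simp

definition position_vector :: "nat \<Rightarrow> int list" where
  "position_vector i = [0, 1, int (Suc i), int (\<Sum>j=0..Suc i. j), int (w ! i)]"

lemma bdd_position_vector:
  assumes "i < length w"
  shows "bdd 3 (position_vector i)"
proof -
  have i: "int (Suc i) \<le> M" using assms w(1) by simp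
  have "(\<Sum>j=0..Suc i. j) \<le> (Suc i + 1) * Suc i"
    using sum_bounded_above[of "{0..Suc i}" "\<lambda>j. j" "Suc i"] by (simp del: sum.atLeast0_atMost_Suc)
  then have "int (\<Sum>j=0..Suc i. j) \<le> int ((Suc i + 1) * Suc i)" by (rule of_nat_mono)
  also have "\<dots> \<le> (M + 1) * M"
    unfolding of_nat_mult of_nat_add using i by (intro mult_mono) auto
  also have "\<dots> \<le> (M * M) * M"
  proof (rule mult_right_mono)
    have "2 * M \<le> M * M" using M_ge by (intro mult_right_mono) auto
    then show "M + 1 \<le> M * M" using M_ge by linarith
  qed (use M_ge in simp)
  finally have "int (\<Sum>j=0..Suc i. j) \<le> M ^ 3" by (simp only: power3_eq_cube)
  moreover have "M \<le> M ^ 3" using power_le[of 1 3] by simp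
  moreover have "int (w ! i) \<le> M" using w(2) assms by simp
  ultimately show ?thesis
    using i M_ge unfolding bdd_def position_vector_def
    by (simp del: sum.atLeast0_atMost_Suc of_nat_Suc of_nat_sum)
qed

lemma initial_vectors_exact:
  "initial_vectors (encoder_in rnd T) w = map (\<lambda>i. ivec (position_vector i)) [0..<length w]"
proof -
  have "map rnd (emb_udec (w ! i) (Suc i)) = ivec (position_vector i)" if "i < length w" for i
  proof -
    have "emb_udec (w ! i) (Suc i) = ivec (position_vector i)"
      by (simp add: emb_udec_def position_vector_def)
    then show ?thesis
      using map_rnd[OF bdd_position_vector[OF that]] by simp
  qed
  moreover have "[1..<length w + 1] = map Suc [0..<length w]" by (simp add: map_Suc_upt)
  ultimately show ?thesis by (simp add: initial_vectors_def encoder_in_def)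
qed

definition feature_vector :: "nat \<Rightarrow> int list" where
  "feature_vector i = features (Suc i) (w ! i)"

lemma feature_bounds: "\<bar>\<delta> k j\<bar> \<le> M" "\<bar>lo k j\<bar> \<le> M" "\<bar>tz k j\<bar> \<le> M"
  using features_bounded[of k j] K by linarith+

text \<open>The entries are known explicitly, so the exponent drops to 1, where
  \<open>fnn_exact\<close> would give 9. This restart keeps the later exponents below 30.\<close>

lemma bdd_feature_vector: "i < length w \<Longrightarrow> bdd 1 (feature_vector i)"
  using w(1) M_ge feature_bounds by (auto simp: bdd_def feature_vector_def features_def block_def)

lemma layer_ok_feature_net: "l \<in> set feature_net \<Longrightarrow> layer_ok l"
proof -
  have ramp: "layer_ok [ramp_row f]" if f: "\<And>k. 4 * \<bar>f k\<bar> \<le> int K" for f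
  proof -
    have "\<bar>second_difference f t\<bar> \<le> M" for t
      using f[of "Suc t"] f[of t] f[of "t - 1"] K by (simp add: second_difference_def)
    then show ?thesis using K M_ge by (auto simp: layer_ok_def ramp_row_def bdd_def)
  qed
  have ramps: "layer_ok (map (\<lambda>j. ramp_row (f j)) [0..<R])" if "\<And>j k. 4 * \<bar>f j k\<bar> \<le> int K" for f
    using ramp[of "f _"] that by (simp add: layer_ok_def)
  have app: "layer_ok (l @ l') \<longleftrightarrow> layer_ok l \<and> layer_ok l'" for l l'
    by (auto simp: layer_ok_def)
  assume "l \<in> set feature_net"
  then consider
    "l = map (\<lambda>t. ([0, 0, 0, 0, 1], - int t)) [0..<K + 2] @ [([0, 0, 1, 0, 0], 0)]"
  | "l = [(map (\<lambda>_. 0) [0..<K + 2] @ [0], 1), (map (\<lambda>_. 0) [0..<K + 2] @ [1], 0)] @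
      map (\<lambda>j. ramp_row (\<lambda>k. \<delta> k j)) [0..<R] @
      map (\<lambda>j. ramp_row (\<lambda>k. lo k j)) [0..<R] @
      map (\<lambda>j. ramp_row (\<lambda>k. tz k j)) [0..<R]"
    by (auto simp: feature_net_def)
  then show "layer_ok l"
  proof cases
    case 1
    then show ?thesis using K M_ge by (auto simp: layer_ok_def bdd_def)
  next
    case 2
    have "layer_ok [(map (\<lambda>_. 0) [0..<K + 2] @ [0], 1), (map (\<lambda>_. 0) [0..<K + 2] @ [1], 0)]"
      using K M_ge by (auto simp: layer_ok_def bdd_def)
    then show ?thesis unfolding 2 app using ramps features_bounded by simp
  qed
qed

lemma feature_layer_exact:
  "layer_step (layer_in rnd feature_layer) (map (\<lambda>i. ivec (position_vector i)) [0..<length w]) =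
     map (\<lambda>i. ivec (feature_vector i)) [0..<length w]"
proof -
  have "apply_fnn rnd (rat_fnn feature_net) (ivec (position_vector i)) = ivec (feature_vector i)"
    if "i < length w" for i
  proof -
    have "int_fnn feature_net (position_vector i) = feature_vector i"
      unfolding position_vector_def feature_vector_def by (rule int_fnn_feature_net)
    moreover have "3 + 3 * length feature_net \<le> 30" by (simp add: feature_net_def)
    ultimately show ?thesis
      using fnn_exact(1)[OF layer_ok_feature_net bdd_position_vector[OF that]] by simp
  qed
  then show ?thesis
    by (simp add: layer_step_def layer_in_def feature_layer_def)
qed

definition before :: "nat \<Rightarrow> nat \<Rightarrow> int" where
  "before i = counter \<delta> (take i w)"

lemma before_Suc: "i < length w \<Longrightarrow> before (Suc i) j = before i j + \<delta> (w ! i) j"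
  by (simp add: before_def take_Suc_conv_app_nth)

lemma before_sum: "i \<le> length w \<Longrightarrow> before i j = (\<Sum>m<i. \<delta> (w ! m) j)"
  by (induction i) (simp_all add: before_Suc, simp add: before_def)

lemma before_bound: "i \<le> length w \<Longrightarrow> \<bar>before i j\<bar> \<le> M ^ 2"
proof -
  assume i: "i \<le> length w"
  have "\<bar>before i j\<bar> \<le> (\<Sum>m<i. M)"
    unfolding before_sum[OF i] by (intro order_trans[OF sum_abs] sum_mono feature_bounds)
  also have "\<dots> \<le> M * M"
    using i w(1) M_ge by (simp add: mult_right_mono)
  finally show ?thesis by (simp add: power2_eq_square)
qed

lemma length_row: "int (length (row a b f g h)) \<le> M"
  using R K by (simp add: row_def)

lemma bdd_unit_rows:
  assumes "\<bar>a\<bar> \<le> 1" "\<bar>b\<bar> \<le> 1" "\<And>l. \<bar>f l\<bar> \<le> 1" "\<And>l. \<bar>g l\<bar> \<le> 1" "\<And>l. \<bar>h l\<bar> \<le> 1"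
  shows "bdd 1 (row a b f g h)"
proof -
  have le: "\<bar>c\<bar> \<le> M" if "\<bar>c\<bar> \<le> 1" for c
    using that M_ge by simp
  show ?thesis
    unfolding bdd_def row_def block_def power_one_right using assms by (auto intro!: le)
qed

lemma unit_row_bound [simp]: "\<bar>unit_row j l\<bar> \<le> 1"
  by (simp add: unit_row_def)

lemma prefix_head_exact:
  assumes m: "m < length w"
  shows "head_value (head_in rnd prefix_head) (map (\<lambda>i. ivec (feature_vector i)) [0..<length w])
      (ivec (feature_vector m)) = ivec (block (before (Suc m)))"
proof -
  define z where "z i = - max 0 (int i - int m)" for i
  have score: "score_in rnd prefix_head (ivec (feature_vector m)) (ivec (feature_vector i)) = of_int (z i)"
    if "i < length w" for i
  proof (rule score_exact)
    show "query_matrix prefix_head = map ivec [row 1 0 zero zero zero, row 0 1 zero zero zero]"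
      "key_matrix prefix_head = map ivec [row 0 1 zero zero zero, row (- 1) 0 zero zero zero]"
      "score_net prefix_head = rat_fnn prefix_score"
      by (simp_all add: prefix_head_def rat_matrix_def)
    show "bdd 1 (feature_vector m)" "bdd 1 (feature_vector i)"
      by (rule bdd_feature_vector, fact)+
    show "layer_ok l" if "l \<in> set prefix_score" for l
      using that M_ge by (auto simp: prefix_score_def layer_ok_def bdd_def)
    show "int_fnn prefix_score [dot (map (\<lambda>r. dot r (feature_vector m)) [row 1 0 zero zero zero, row 0 1 zero zero zero])
        (map (\<lambda>r. dot r (feature_vector i)) [row 0 1 zero zero zero, row (- 1) 0 zero zero zero])] = [z i]"
      by (simp add: dot_row feature_vector_def prefix_score_def affine_def z_def)
  qed (use M_ge in \<open>auto simp: matrix_ok_def prefix_score_def simp del: One_nat_def intro!: bdd_unit_rows length_row\<close>)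
  let ?W = "map (\<lambda>j. row 0 0 (unit_row j) zero zero) [0..<R]"
  have "head_value (head_in rnd prefix_head) (map (\<lambda>i. ivec (feature_vector i)) [0..<length w])
      (ivec (feature_vector m)) =
      ivec (map (\<lambda>r. \<Sum>i | i < length w \<and> (\<forall>j<length w. z j \<le> z i). dot r (feature_vector i)) ?W)"
  proof (rule head_exact[OF _ _ bdd_feature_vector w(1) _ score])
    show "value_matrix prefix_head = map ivec ?W"
      by (simp add: prefix_head_def rat_matrix_def)
    show "matrix_ok ?W"
      by (auto simp: matrix_ok_def simp del: One_nat_def intro!: bdd_unit_rows length_row)
  qed simp_all
  \<comment> \<open>The score is 0 up to position \<open>m\<close> and negative beyond it;
    \<open>m\<close> itself attains the maximum.\<close>
  also have "{i. i < length w \<and> (\<forall>j<length w. z j \<le> z i)} = {..<Suc m}"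
    using m by (force simp: z_def)
  also have "map (\<lambda>r. \<Sum>i<Suc m. dot r (feature_vector i)) ?W = block (before (Suc m))"
    using m by (simp add: block_def before_sum dot_row feature_vector_def sum_unit_row del: sum.lessThan_Suc)
  finally show ?thesis .
qed

definition check_vector :: "nat \<Rightarrow> int list" where
  "check_vector i =
     [\<Sum>j<R. violation (before i j) (lo (w ! i) j) (tz (w ! i) j),
      \<bar>before (Suc i) 0 - hlt\<bar>, max 0 (before (Suc i) 1)]"

lemma layer_ok_check_net: "l \<in> set check_net \<Longrightarrow> layer_ok l"
proof -
  assume "l \<in> set check_net"
  have bdd_app: "bdd t (u @ v) \<longleftrightarrow> bdd t u \<and> bdd t v" for t u v by (auto simp: bdd_def)
  have block: "bdd 1 (block f)" if "\<And>l. \<bar>f l\<bar> \<le> 2" for f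
  proof -
    have le: "\<bar>c\<bar> \<le> M" if "\<bar>c\<bar> \<le> 2" for c
      using that M_ge by simp
    show ?thesis
      unfolding bdd_def block_def power_one_right using that by (auto intro!: le)
  qed
  have row_length: "int (length (row a b f g h)) + int R \<le> M" for a b f g h
    using R K by (simp add: row_def)
  have neuron: "bdd 1 (row 0 0 f g h @ block e)"
    if "\<And>l. \<bar>f l\<bar> \<le> 1" "\<And>l. \<bar>g l\<bar> \<le> 1" "\<And>l. \<bar>h l\<bar> \<le> 1" "\<And>l. \<bar>e l\<bar> \<le> 1" for f g h e
  proof -
    have "\<bar>e l\<bar> \<le> 2" for l using that(4)[of l] by linarith
    then have "bdd 1 (block e)" by (rule block)
    moreover have "bdd 1 (row 0 0 f g h)" using that by (intro bdd_unit_rows) simp_all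
    ultimately show ?thesis by (simp add: bdd_app)
  qed
  from \<open>l \<in> set check_net\<close> consider "l = check_net ! 0" | "l = check_net ! 1"
    by (auto simp: check_net_def)
  then show "layer_ok l"
  proof cases
    case 1
    then show ?thesis
      using hlt K M_ge
      by (auto simp: check_net_def layer_ok_def row_length simp del: One_nat_def intro!: neuron)
  next
    case 2
    have "bdd 1 (block f @ block g @ block h @ [a, b, c])"
      if "\<And>l. \<bar>f l\<bar> \<le> 2" "\<And>l. \<bar>g l\<bar> \<le> 2" "\<And>l. \<bar>h l\<bar> \<le> 2" "\<bar>a\<bar> \<le> 1" "\<bar>b\<bar> \<le> 1" "\<bar>c\<bar> \<le> 1"
      for f g h a b c
      using that M_ge block[of f] block[of g] block[of h] by (auto simp: bdd_app) (auto simp: bdd_def)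
    moreover have "3 + 3 * int R \<le> M" using R K by simp
    ultimately show ?thesis
      using 2 M_ge by (auto simp: check_net_def layer_ok_def simp del: One_nat_def)
  qed
qed

lemma check_layer_vector:
  assumes i: "i < length w"
  shows "apply_fnn rnd (rat_fnn check_net) (ivec (feature_vector i @ block (before (Suc i)))) =
      ivec (check_vector i)"
    and "bdd 8 (check_vector i)"
proof -
  have "bdd 2 (feature_vector i)" using bdd_mono[OF bdd_feature_vector[OF i]] by simp
  moreover have "bdd 2 (block (before (Suc i)))"
    using before_bound[of "Suc i"] i by (auto simp: bdd_def block_def)
  ultimately have bdd: "bdd 2 (feature_vector i @ block (before (Suc i)))"
    unfolding bdd_def set_append by blast
  have eval: "int_fnn check_net (feature_vector i @ block (before (Suc i))) = check_vector i"
    unfolding feature_vector_def int_fnn_check_net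
    by (simp add: check_vector_def before_Suc[OF i])
  have len: "length check_net = 2" by (simp add: check_net_def)
  show "apply_fnn rnd (rat_fnn check_net) (ivec (feature_vector i @ block (before (Suc i)))) =
      ivec (check_vector i)"
    using fnn_exact(1)[where N = check_net, OF layer_ok_check_net bdd] eval len by simp
  show "bdd 8 (check_vector i)"
    using fnn_exact(2)[where N = check_net, OF layer_ok_check_net bdd] eval len by simp
qed

lemma check_layer_exact:
  "layer_step (layer_in rnd check_layer) (map (\<lambda>i. ivec (feature_vector i)) [0..<length w]) =
     map (\<lambda>i. ivec (check_vector i)) [0..<length w]"
  using check_layer_vector(1)
  by (auto simp: layer_step_def layer_in_def check_layer_def prefix_head_exact)

definition total_violation :: int where
  "total_violation = (\<Sum>i<length w. \<Sum>j<R. violation (before i j) (lo (w ! i) j) (tz (w ! i) j))"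

definition final_vector :: "nat \<Rightarrow> int list" where
  "final_vector i = [\<bar>before (Suc i) 0 - hlt\<bar> + total_violation, max 0 (before (Suc i) 1)]"

lemma sum_head_exact:
  assumes m: "m < length w"
  shows "head_value (head_in rnd sum_head) (map (\<lambda>i. ivec (check_vector i)) [0..<length w])
      (ivec (check_vector m)) = ivec [total_violation]"
proof -
  have score: "score_in rnd sum_head (ivec (check_vector m)) (ivec (check_vector i)) = of_int 0"
    if "i < length w" for i
  proof (rule score_exact)
    show "query_matrix sum_head = map ivec []" "key_matrix sum_head = map ivec []"
      "score_net sum_head = rat_fnn [[([1], 0)]]"
      by (simp_all add: sum_head_def)
    show "bdd 8 (check_vector m)" "bdd 8 (check_vector i)"
      by (rule check_layer_vector(2), fact)+
    show "layer_ok l" if "l \<in> set [[([1], 0)]]" for l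
      using that M_ge by (auto simp: layer_ok_def bdd_def)
  qed (use M_ge in \<open>auto simp: matrix_ok_def affine_def\<close>)
  have "head_value (head_in rnd sum_head) (map (\<lambda>i. ivec (check_vector i)) [0..<length w])
      (ivec (check_vector m)) =
      ivec (map (\<lambda>r. \<Sum>i | i < length w \<and> (\<forall>j<length w. (0::int) \<le> 0). dot r (check_vector i)) [[1, 0, 0]])"
  proof (rule head_exact[OF _ _ check_layer_vector(2) w(1) _ score])
    show "value_matrix sum_head = map ivec [[1, 0, 0]]"
      by (simp add: sum_head_def rat_matrix_def)
    show "matrix_ok [[1, 0, 0]]" using M_ge by (simp add: matrix_ok_def bdd_def)
  qed simp_all
  also have "{i. i < length w \<and> (\<forall>j<length w. (0::int) \<le> 0)} = {..<length w}" by auto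
  finally show ?thesis by (simp add: total_violation_def check_vector_def)
qed

lemma bdd_total_violation: "\<bar>total_violation\<bar> \<le> M ^ 9"
proof -
  have "\<bar>total_violation\<bar> \<le> (\<Sum>i<length w. M ^ 8)"
    unfolding total_violation_def
    by (rule order_trans[OF sum_abs], rule sum_mono)
      (use check_layer_vector(2) in \<open>simp add: bdd_def check_vector_def\<close>)
  also have "\<dots> \<le> M * M ^ 8"
    using w(1) M_ge by (simp add: mult_right_mono)
  also have "\<dots> = M ^ 9" by (simp add: eval_nat_numeral)
  finally show ?thesis .
qed

lemma sum_layer_vector:
  assumes i: "i < length w"
  shows "apply_fnn rnd (rat_fnn sum_comb) (ivec (check_vector i @ [total_violation])) = ivec (final_vector i)"
    and "bdd 12 (final_vector i)"
proof -
  have "bdd 9 (check_vector i)" using bdd_mono[OF check_layer_vector(2)[OF i]] by simp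
  then have bdd: "bdd 9 (check_vector i @ [total_violation])"
    using bdd_total_violation by (simp add: bdd_def)
  have eval: "int_fnn sum_comb (check_vector i @ [total_violation]) = final_vector i"
    by (simp add: sum_comb_def affine_def check_vector_def final_vector_def)
  have ok: "layer_ok l" if "l \<in> set sum_comb" for l
    using that M_ge by (auto simp: sum_comb_def layer_ok_def bdd_def)
  have len: "length sum_comb = 1" by (simp add: sum_comb_def)
  show "apply_fnn rnd (rat_fnn sum_comb) (ivec (check_vector i @ [total_violation])) = ivec (final_vector i)"
    using fnn_exact(1)[where N = sum_comb, OF ok bdd] eval len by simp
  show "bdd 12 (final_vector i)"
    using fnn_exact(2)[where N = sum_comb, OF ok bdd] eval len by simp
qed

lemma sum_layer_exact:
  "layer_step (layer_in rnd sum_layer) (map (\<lambda>i. ivec (check_vector i)) [0..<length w]) =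
     map (\<lambda>i. ivec (final_vector i)) [0..<length w]"
  using sum_layer_vector(1)
  by (auto simp: layer_step_def layer_in_def sum_layer_def sum_head_exact)

lemma total_violation_nonneg: "0 \<le> total_violation"
  unfolding total_violation_def by (intro sum_nonneg violation(1) tz)

lemma total_violation_eq_0_iff: "total_violation = 0 \<longleftrightarrow> legal R \<delta> lo tz w"
proof -
  have nonneg: "0 \<le> violation (before i j) (lo k j) (tz k j)" for i j k
    by (intro violation(1) tz)
  have "total_violation = 0 \<longleftrightarrow> (\<forall>i<length w. \<forall>j<R. violation (before i j) (lo (w ! i) j) (tz (w ! i) j) = 0)"
    unfolding total_violation_def
    by (subst sum_nonneg_eq_0_iff; (simp add: sum_nonneg nonneg)?) (subst sum_nonneg_eq_0_iff; auto simp: nonneg)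
  also have "\<dots> \<longleftrightarrow> legal R \<delta> lo tz w"
    using violation(2)[OF tz] by (simp add: legal_def before_def)
  finally show ?thesis .
qed

text \<open>The output is 1 minus a sum of nonnegative defects, so it is 1 only if all of them
  vanish. Positivity of \<open>x\<close> matters because the network sees counter 1 only through
  \<open>max 0\<close>.\<close>

theorem run_encoder_iff:
  assumes "w \<noteq> []" "int x \<le> M" "0 < x"
    and T: "layer_descs T = [feature_layer, check_layer, sum_layer]" "out_net T = rat_fnn (output_net x)"
  shows "run_encoder (encoder_in rnd T) w = 1 \<longleftrightarrow>
    legal R \<delta> lo tz w \<and> counter \<delta> w 0 = hlt \<and> counter \<delta> w 1 = int x"
proof -
  let ?l = "length w - 1"
  have l: "?l < length w" using assms(1) by simp
  have ok: "layer_ok l" if "l \<in> set (output_net x)" for l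
    using that M_ge assms(2) by (auto simp: output_net_def layer_ok_def bdd_def)
  have len: "length (output_net x) = 3" by (simp add: output_net_def)
  have "last (fold layer_step (layers (encoder_in rnd T)) (initial_vectors (encoder_in rnd T) w)) =
      ivec (final_vector ?l)"
    using assms(1) unfolding initial_vectors_exact
    by (simp add: encoder_in_def T(1) feature_layer_exact check_layer_exact sum_layer_exact last_conv_nth)
  then have "run_encoder (encoder_in rnd T) w = hd (apply_fnn rnd (rat_fnn (output_net x)) (ivec (final_vector ?l)))"
    by (simp add: run_encoder_def encoder_in_def T(2))
  also have "apply_fnn rnd (rat_fnn (output_net x)) (ivec (final_vector ?l)) =
      ivec (int_fnn (output_net x) (final_vector ?l))"
    using fnn_exact(1)[OF ok sum_layer_vector(2)[OF l]] len by simp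
  also have "int_fnn (output_net x) (final_vector ?l) =
      [1 - \<bar>max 0 (before (length w) 1) - int x\<bar> - (\<bar>before (length w) 0 - hlt\<bar> + total_violation)]"
  proof -
    have "Suc ?l = length w" using l by simp
    then have "final_vector ?l = [\<bar>before (length w) 0 - hlt\<bar> + total_violation, max 0 (before (length w) 1)]"
      unfolding final_vector_def by (simp only:)
    then show ?thesis
      using int_fnn_output[of "\<bar>before (length w) 0 - hlt\<bar> + total_violation" "max 0 (before (length w) 1)" x]
        total_violation_nonneg by simp
  qed
  finally have "run_encoder (encoder_in rnd T) w =
      of_int (1 - \<bar>max 0 (before (length w) 1) - int x\<bar> - (\<bar>before (length w) 0 - hlt\<bar> + total_violation))"
    by simp
  moreover have "of_int z = (1 :: rat) \<longleftrightarrow> z = 1" for z by simp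
  ultimately have "run_encoder (encoder_in rnd T) w = 1 \<longleftrightarrow>
      1 - \<bar>max 0 (before (length w) 1) - int x\<bar> - (\<bar>before (length w) 0 - hlt\<bar> + total_violation) = 1"
    by (simp only:)
  also have "\<dots> \<longleftrightarrow> total_violation = 0 \<and> before (length w) 0 = hlt \<and> before (length w) 1 = int x"
    using total_violation_nonneg assms(3) by (auto simp: max_def)
  finally show ?thesis
    by (simp add: total_violation_eq_0_iff before_def)
qed

end

section \<open>Diagonalisation\<close>

definition computable :: "(nat \<Rightarrow> nat) \<Rightarrow> bool" where
  "computable F \<longleftrightarrow> (\<exists>r. \<forall>x. computes r [x] (F x))"

lemma computable_id: "computable (\<lambda>x. x)"
  unfolding computable_def by (rule exI[of _ "Proj 0"]) (simp add: computes_iffs)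

lemma computes_Comp1: "computes g xs y \<Longrightarrow> computes f [y] z \<Longrightarrow> computes (Comp f [g]) xs z"
  unfolding computes_Comp_iff by (intro exI[of _ "[y]"]) simp

lemma computes_Comp2:
  "computes g xs y \<Longrightarrow> computes h xs y' \<Longrightarrow> computes f [y, y'] z \<Longrightarrow> computes (Comp f [g, h]) xs z"
  unfolding computes_Comp_iff by (intro exI[of _ "[y, y']"]) simp

lemma computable_Suc:
  assumes "computable F"
  shows "computable (\<lambda>x. Suc (F x))"
proof -
  obtain r where "computes r [x] (F x)" for x using assms unfolding computable_def by blast
  then have "computes (Comp Succ [r]) [x] (Suc (F x))" for x
    by (rule computes_Comp1) (rule computes.succ)
  then show ?thesis unfolding computable_def by blast
qed

lemma computable_const: "computable (\<lambda>x. n)"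
proof (induction n)
  case 0
  show ?case unfolding computable_def using computes.zero by blast
qed (rule computable_Suc)

definition add_rec :: recf where
  "add_rec = Prim_Rec (Proj 0) (Comp Succ [Proj 1])"

lemma computes_add: "computes add_rec [m, n] (m + n)"
proof (induction m)
  case 0
  show ?case by (simp add: add_rec_def computes_iffs)
next
  case (Suc m)
  have "computes (Comp Succ [Proj 1]) [m, m + n, n] (Suc (m + n))"
    by (rule computes_Comp1[OF _ computes.succ]) (simp add: computes_iffs)
  with Suc show ?case unfolding add_rec_def computes_Prim_Rec_Suc_iff by auto
qed

text \<open>Triangular numbers are the core of \<open>prod_encode\<close>, which maps
  \<open>(m, n)\<close> to \<open>triangle (m + n) + m\<close>.\<close>

definition triangle_rec :: recf where
  "triangle_rec = Prim_Rec Zero (Comp Succ [Comp add_rec [Proj 0, Proj 1]])"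

lemma computes_triangle: "computes triangle_rec [n] (triangle n)"
proof (induction n)
  case 0
  show ?case by (simp add: triangle_rec_def computes_iffs)
next
  case (Suc n)
  have "computes (Comp add_rec [Proj 0, Proj 1]) [n, triangle n] (n + triangle n)"
    by (rule computes_Comp2[OF _ _ computes_add]) (simp_all add: computes_iffs)
  then have "computes (Comp Succ [Comp add_rec [Proj 0, Proj 1]]) [n, triangle n] (Suc (n + triangle n))"
    by (rule computes_Comp1) (rule computes.succ)
  then show ?case
    using Suc unfolding triangle_rec_def computes_Prim_Rec_Suc_iff by (auto simp: add.commute)
qed

lemma computable_add:
  assumes "computable F" "computable G"
  shows "computable (\<lambda>x. F x + G x)"
proof -
  obtain r s where "computes r [x] (F x)" "computes s [x] (G x)" for x
    using assms unfolding computable_def by blast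
  then have "computes (Comp add_rec [r, s]) [x] (F x + G x)" for x
    by (rule computes_Comp2) (rule computes_add)
  then show ?thesis unfolding computable_def by blast
qed

lemma computable_prod_encode:
  assumes "computable F" "computable G"
  shows "computable (\<lambda>x. prod_encode (F x, G x))"
proof -
  have "computable (\<lambda>x. triangle (F x + G x))"
  proof -
    obtain r where "computes r [x] (F x + G x)" for x
      using computable_add[OF assms] unfolding computable_def by blast
    then have "computes (Comp triangle_rec [r]) [x] (triangle (F x + G x))" for x
      by (rule computes_Comp1) (rule computes_triangle)
    then show ?thesis unfolding computable_def by blast
  qed
  then show ?thesis
    using computable_add assms(1) by (simp add: prod_encode_def)
qed

lemma computable_list_encode_Cons:
  "computable F \<Longrightarrow> computable (\<lambda>x. list_encode (G x)) \<Longrightarrow> computable (\<lambda>x. list_encode (F x # G x))"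
  using computable_Suc[OF computable_prod_encode] by simp

lemma code_rat_of_int: "code_rat (of_int z) = prod_encode (int_encode z, int_encode 1)"
  by (simp add: code_rat_def)

lemma computable_code_rat: "computable (\<lambda>x. code_rat (of_int (int x)))"
proof -
  have "code_rat (of_int (int x)) = prod_encode (x + x, int_encode 1)" for x
    unfolding code_rat_of_int by (simp add: int_encode_def sum_encode_def)
  then show ?thesis
    by (simp add: computable_prod_encode computable_add computable_id computable_const)
qed

text \<open>Exactness up to \<open>N ^ 30\<close> takes 30 bits for every bit of \<open>N\<close>,
  and a sign; 32 leaves room for it.\<close>

definition integer_scheme :: fwa_scheme where
  "integer_scheme = \<lparr>kind = Fixed_Point, overflow_mode = Saturate, rounding_mode = Round_Up,
     width1 = (32, 0), width2 = (0, 0)\<rparr>"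

lemma floorlog_pos: "1 \<le> N \<Longrightarrow> 1 \<le> floorlog 2 N"
  by (simp add: floorlog_def)

lemma integer_arithmetic_scheme:
  assumes "2 \<le> N"
  shows "integer_arithmetic (scheme_round integer_scheme N) (int N) 30"
proof -
  let ?f = "floorlog 2 N"
  define p where "p = 32 * ?f"
  have rnd: "scheme_round integer_scheme N r = of_int \<lceil>r\<rceil>"
    if "- (2 ^ (p - 1)) \<le> r" "r \<le> 2 ^ (p - 1) - 1" for r
    using fwa_round_integers[OF that]
    by (simp add: scheme_round_def integer_scheme_def width_at_def p_def)
  have f: "N < 2 ^ ?f" "0 < ?f"
    using floorlog_bounds[of N 2] floorlog_pos[of N] assms by auto
  have "N ^ 30 < (2 ^ ?f) ^ 30"
    using f(1) by (intro power_strict_mono) auto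
  also have "\<dots> = 2 ^ (30 * ?f)" by (simp add: power_mult[symmetric] mult.commute)
  also have "\<dots> \<le> 2 ^ (p - 1)"
    using f(2) by (intro power_increasing) (auto simp: p_def)
  finally have "int (N ^ 30) < int (2 ^ (p - 1))" by (rule of_nat_less_iff[THEN iffD2])
  then have big: "int N ^ 30 < 2 ^ (p - 1)" by simp
  show ?thesis
  proof
    show "2 \<le> int N" using assms by simp
    show "scheme_round integer_scheme N (of_int z) = of_int z" if "\<bar>z\<bar> \<le> int N ^ 30" for z
    proof -
      have "- (2 ^ (p - 1)) \<le> z" "z \<le> 2 ^ (p - 1) - 1" using that big by linarith+
      then have "rat_of_int (- (2 ^ (p - 1))) \<le> of_int z" "rat_of_int z \<le> of_int (2 ^ (p - 1) - 1)"
        by (simp_all only: of_int_le_iff)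
      then show ?thesis by (subst rnd) simp_all
    qed
    show "scheme_round integer_scheme N (1 / of_nat m) = 1" if "0 < m" for m
    proof -
      have m: "0 < 1 / rat_of_nat m" "1 / rat_of_nat m \<le> 1" using that by simp_all
      have "1 < (2::int) ^ (p - 1)" using f(2) by (intro one_less_power) (auto simp: p_def)
      then have "rat_of_int 2 \<le> of_int (2 ^ (p - 1))" by (simp only: of_int_le_iff)
      then have "(2::rat) \<le> 2 ^ (p - 1)" by simp
      then have "- (2 ^ (p - 1)) \<le> 1 / rat_of_nat m" "1 / rat_of_nat m \<le> 2 ^ (p - 1) - 1"
        using m by linarith+
      moreover have "\<lceil>1 / rat_of_nat m\<rceil> = 1" using m by (simp add: ceiling_eq_iff)
      ultimately show ?thesis using rnd by simp
    qed
  qed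
qed

lemma scheme_wf_integer_scheme: "scheme_wf integer_scheme"
  using floorlog_pos by (fastforce simp: scheme_wf_def integer_scheme_def width_at_def)

text \<open>For \<open>2 \<le> N\<close>, \<open>floorlog 2 N\<close> is at most
  \<open>log 2 N + 1\<close> and hence at most \<open>2 * log 2 N\<close>, which doubles the factor
  32.\<close>

lemma scheme_bits_integer_scheme:
  assumes "64 \<le> c" "2 \<le> N"
  shows "real (scheme_bits integer_scheme N) \<le> real c * log 2 (real N)"
proof -
  have log: "1 \<le> log 2 (real N)" using assms(2) by (simp add: le_log_iff)
  have "real (floorlog 2 N) \<le> log 2 (real N) + 1"
    using assms(2) log by (simp add: floorlog_def)
  then have "real (scheme_bits integer_scheme N) \<le> 64 * log 2 (real N)"
    using log by (simp add: scheme_bits_def integer_scheme_def width_at_def)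
  also have "\<dots> \<le> real c * log 2 (real N)" using assms(1) log by (intro mult_right_mono) auto
  finally show ?thesis .
qed

text \<open>The alphabet size makes \<open>max |\<Sigma>| n\<close> exceed \<open>x\<close> on every
  word, so that \<open>x\<close> is represented exactly even if the word is short.\<close>

definition instance_of :: "layer_desc list \<Rightarrow> nat \<Rightarrow> encoder_desc \<times> fwa_scheme" where
  "instance_of ls x =
     (\<lparr>alphabet_size = Suc x, layer_descs = ls, out_net = rat_fnn (output_net x)\<rparr>, integer_scheme)"

text \<open>
  The code of \<open>instance_of ls x\<close> depends on \<open>ls\<close> only through the code of \<open>ls\<close>. For \<open>x\<close> equal to that
  code, it is therefore a computable function of \<open>x\<close> alone.
\<close>

definition diagonal_code :: "nat \<Rightarrow> nat" where
  "diagonal_code x = prod_encode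
     (list_encode [Suc x, x, code_fnn (rat_fnn (output_net x))], code_scheme integer_scheme)"

lemma code_instance_diagonal:
  "x = code_list code_layer ls \<Longrightarrow> code_instance (instance_of ls x) = diagonal_code x"
  by (simp add: diagonal_code_def instance_of_def code_instance_def code_encoder_def)

lemma computable_diagonal_code: "computable diagonal_code"
proof -
  have "computable (\<lambda>x. code_fnn (rat_fnn (output_net x)))"
    unfolding code_fnn_def rat_fnn_def output_net_def code_list_def list.map prod.case
    by (intro computable_list_encode_Cons computable_prod_encode computable_code_rat computable_const)
  then show ?thesis
    unfolding diagonal_code_def[abs_def]
    by (intro computable_list_encode_Cons computable_prod_encode computable_Suc computable_id computable_const)
qed

lemma length_le_list_encode: "length xs \<le> list_encode xs"
  by (induction xs) (auto intro: order_trans[OF _ le_prod_encode_2])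

section \<open>Membership of the instances in the class, and their satisfiability\<close>

context counter_system
begin

definition encoder_layers :: "layer_desc list" where
  "encoder_layers = [feature_layer, check_layer, sum_layer]"

text \<open>A list code is at least the length of the list, and the hidden layer of
  \<open>feature_net\<close> has \<open>K + 3\<close> neurons. An \<open>x\<close> equal to this
  code is therefore automatically large enough for exact arithmetic and for all letters up to
  \<open>K\<close>.\<close>

lemma K_le_code: "K + 3 \<le> code_list code_layer encoder_layers"
proof -
  have "K + 3 \<le> length (hd (rat_fnn feature_net))"
    by (simp add: feature_net_def rat_fnn_def)
  also have "\<dots> \<le> code_list (\<lambda>(w, b). prod_encode (code_list code_rat w, code_rat b)) (hd (rat_fnn feature_net))"
    using length_le_list_encode[of "map _ (hd (rat_fnn feature_net))"] by (simp add: code_list_def)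
  also have "\<dots> \<le> code_fnn (rat_fnn feature_net)"
    by (simp add: code_fnn_def feature_net_def rat_fnn_def code_list_def le_SucI le_prod_encode_1 del: upt_Suc)
  also have "\<dots> \<le> code_layer feature_layer"
    by (simp add: code_layer_def feature_layer_def le_prod_encode_2)
  also have "\<dots> \<le> code_list code_layer encoder_layers"
    by (simp add: encoder_layers_def code_list_def le_SucI le_prod_encode_1)
  finally show ?thesis .
qed

lemma instance_in_class:
  assumes "64 \<le> c"
  shows "instance_of encoder_layers x \<in> TE_udec_log c"
proof -
  have len: "length (row a b f g h) = 2 + 3 * R" for a b f g h
    by (simp add: row_def)
  have "layer_wf 5 feature_layer (2 + 3 * R)"
    by (auto simp: layer_wf_def feature_layer_def is_fnn_def rat_fnn_def feature_net_def ramp_row_def)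
  moreover have "layer_wf (2 + 3 * R) check_layer 3"
    by (auto simp: layer_wf_def check_layer_def is_fnn_def rat_fnn_def check_net_def head_wf_def
        prefix_head_def rat_matrix_def matrix_dims_def prefix_score_def len)
  moreover have "layer_wf 3 sum_layer 2"
    by (auto simp: layer_wf_def sum_layer_def is_fnn_def rat_fnn_def sum_comb_def head_wf_def
        sum_head_def rat_matrix_def matrix_dims_def)
  moreover have "is_fnn 2 (rat_fnn (output_net x)) 1"
    by (simp add: is_fnn_def rat_fnn_def output_net_def)
  ultimately have "fst (instance_of encoder_layers x) \<in> TE_udec"
    unfolding TE_udec_def instance_of_def encoder_layers_def by auto
  then show ?thesis
    using scheme_wf_integer_scheme scheme_bits_integer_scheme[OF assms]
    by (auto simp: TE_udec_log_def instance_of_def Let_def)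
qed

text \<open>The arithmetic varies with the word, so the encoder locale is interpreted for each word
  separately, with \<open>M = max (Suc x) (length w)\<close>. The empty word drops out since its
  counters are 0 and \<open>x\<close> is positive.\<close>

lemma satisfiable_instance_iff:
  assumes "K + 3 \<le> x"
  shows "satisfiable_log (instance_of encoder_layers x) \<longleftrightarrow>
    (\<exists>w. set w \<subseteq> {1..Suc x} \<and> legal R \<delta> lo tz w \<and> counter \<delta> w 0 = hlt \<and> counter \<delta> w 1 = int x)"
proof -
  have run: "run_log (instance_of encoder_layers x) w = 1 \<longleftrightarrow>
      legal R \<delta> lo tz w \<and> counter \<delta> w 0 = hlt \<and> counter \<delta> w 1 = int x"
    if "w \<noteq> []" "set w \<subseteq> {1..Suc x}" for w
  proof -
    let ?N = "max (Suc x) (length w)"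
    interpret integer_arithmetic "scheme_round integer_scheme ?N" "int ?N" 30
      by (rule integer_arithmetic_scheme) (use assms R in auto)
    interpret counter_system_encoder K R \<delta> lo tz hlt "scheme_round integer_scheme ?N" "int ?N" w
    proof unfold_locales
      show "int k \<le> int ?N" if "k \<in> set w" for k
      proof -
        have "k \<in> {1..Suc x}" using that \<open>set w \<subseteq> {1..Suc x}\<close> by blast
        then show ?thesis by (simp add: le_max_iff_disj)
      qed
    qed (use assms in auto)
    show ?thesis
      unfolding run_log_def instance_of_def prod.case encoder_desc.select_convs
      by (rule run_encoder_iff) (use that assms in \<open>auto simp: encoder_layers_def\<close>)
  qed
  have "w \<noteq> []" if "counter \<delta> w 1 = int x" for w
    using that assms by auto
  with run show ?thesis
    unfolding satisfiable_log_def by (auto simp: instance_of_def)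
qed

end

text \<open>The layers come from \<open>h\<close> alone and serve all \<open>x\<close>; this order
  of quantifiers is what later allows \<open>x\<close> to be their code.\<close>

lemma halting_instance:
  "\<exists>ls. (\<forall>c\<ge>64. \<forall>x. instance_of ls x \<in> TE_udec_log c) \<and>
     (\<forall>x\<ge>code_list code_layer ls. satisfiable_log (instance_of ls x) \<longleftrightarrow> computes h [x] 0)"
proof -
  obtain q where q: "implements h [1] 2 3 q"
    using implementable[of "[1]" 3 2 h] by auto
  \<comment> \<open>Register 0 keeps the guess, which is read off as counter 1; register 1 is the
    argument of \<open>h\<close> and register 2 its result.\<close>
  let ?guess = "Seq (Act (Inc 0)) (Act (Inc 1))"
  let ?p = "Seq (Star ?guess) (Seq q (Act (Test 2)))"
  define \<sigma> :: "nat \<Rightarrow> nat \<Rightarrow> nat" where "\<sigma> i = (\<lambda>_. 0)(0 := i, 1 := i)" for i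
  have body: "exec ?guess (\<sigma> i) s \<longleftrightarrow> s = \<sigma> (Suc i)" for i s
  proof -
    have "exec ?guess u s \<longleftrightarrow> s = u(0 := Suc (u 0), 1 := Suc (u 1))" for u
      by (auto simp: relcompp_apply)
    moreover have "(\<sigma> i)(0 := Suc (\<sigma> i 0), 1 := Suc (\<sigma> i 1)) = \<sigma> (Suc i)"
      by (auto simp: \<sigma>_def fun_eq_iff)
    ultimately show ?thesis by (simp only:)
  qed
  have "exec (Star ?guess) (\<sigma> 0) s \<longleftrightarrow> (\<exists>i. True \<and> s = \<sigma> i)" for s
    by (rule exec_Star_count) (simp_all only: body simp_thms)
  moreover have "\<sigma> 0 = (\<lambda>_. 0)" by (simp add: \<sigma>_def fun_eq_iff)
  ultimately have guess: "exec (Star ?guess) (\<lambda>_. 0) s \<longleftrightarrow> (\<exists>i. s = \<sigma> i)" for s by simp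
  have "exec q (\<sigma> i) s \<longleftrightarrow> (\<exists>y. computes h [i] y \<and> s = (\<sigma> i)(2 := y))" for i s
    using implementsD[OF q, of "\<sigma> i"] by (simp add: \<sigma>_def)
  then have rest: "exec (Seq q (Act (Test 2))) (\<sigma> i) s \<longleftrightarrow> computes h [i] 0 \<and> s = (\<sigma> i)(2 := 0)" for i s
    by (auto simp: relcompp_apply)
  have run: "exec ?p (\<lambda>_. 0) s \<longleftrightarrow> (\<exists>i. computes h [i] 0 \<and> s = (\<sigma> i)(2 := 0))" for s
  proof -
    have "exec ?p (\<lambda>_. 0) s \<longleftrightarrow> (\<exists>i. exec (Seq q (Act (Test 2))) (\<sigma> i) s)"
      unfolding exec.simps(2)[of "Star ?guess"] relcompp_apply[of "exec (Star ?guess)"] guess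
      by (auto simp del: exec.simps)
    then show ?thesis unfolding rest .
  qed
  have exec_iff: "(\<exists>s. exec ?p (\<lambda>_. 0) s \<and> s 0 = x) \<longleftrightarrow> computes h [x] 0" for x
    unfolding run by (auto simp: \<sigma>_def)
  obtain K R \<delta> lo tz hlt where system: "counter_system K R \<delta> lo tz hlt"
    and complete: "\<forall>s. exec ?p (\<lambda>_. 0) s \<longrightarrow>
      (\<exists>w. set w \<subseteq> {1..K} \<and> legal R \<delta> lo tz w \<and> counter \<delta> w 0 = hlt \<and> counter \<delta> w 1 = int (s 0))"
    and sound: "\<forall>w. legal R \<delta> lo tz w \<and> counter \<delta> w 0 = hlt \<longrightarrow>
      (\<exists>s. exec ?p (\<lambda>_. 0) s \<and> counter \<delta> w 1 = int (s 0))"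
    by (rule counter_system_of_program)
  interpret counter_system K R \<delta> lo tz hlt by (rule system)
  have "satisfiable_log (instance_of encoder_layers x) \<longleftrightarrow> computes h [x] 0"
    if "code_list code_layer encoder_layers \<le> x" for x
  proof -
    from that
    have x: "K + 3 \<le> x" using K_le_code by linarith
    have "(\<exists>w. set w \<subseteq> {1..Suc x} \<and> legal R \<delta> lo tz w \<and> counter \<delta> w 0 = hlt \<and> counter \<delta> w 1 = int x) \<longleftrightarrow>
        (\<exists>s. exec ?p (\<lambda>_. 0) s \<and> s 0 = x)" (is "?lhs \<longleftrightarrow> ?rhs")
    proof
      assume ?lhs
      then obtain w where w: "legal R \<delta> lo tz w" "counter \<delta> w 0 = hlt" "counter \<delta> w 1 = int x" by blast
      with sound obtain s where s: "exec ?p (\<lambda>_. 0) s" "counter \<delta> w 1 = int (s 0)" by blast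
      from s(2) have "s 0 = x" unfolding w(3) by simp
      with s(1) show ?rhs by blast
    next
      assume ?rhs
      then obtain s where s: "exec ?p (\<lambda>_. 0) s" "s 0 = x" by blast
      with complete obtain w where w: "set w \<subseteq> {1..K}" "legal R \<delta> lo tz w" "counter \<delta> w 0 = hlt"
        "counter \<delta> w 1 = int (s 0)" by blast
      have "{1..K} \<subseteq> {1..Suc x}" using x by auto
      with w s(2) show ?lhs by blast
    qed
    then show "satisfiable_log (instance_of encoder_layers x) \<longleftrightarrow> computes h [x] 0"
      unfolding satisfiable_instance_iff[OF x] exec_iff .
  qed
  then show ?thesis using instance_in_class by blast
qed

theorem theorem2:
  shows "\<exists>c\<^sub>0. \<forall>c\<ge>c\<^sub>0. \<not> decidable_problem code_instance (TE_udec_log c) satisfiable_log"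
proof (intro exI allI impI notI)
  fix c :: nat
  \<comment> \<open>This assumption instantiates the threshold \<open>c\<^sub>0\<close> with 64, the
    constant of \<open>scheme_bits_integer_scheme\<close>.\<close>
  assume c: "64 \<le> c" and "decidable_problem code_instance (TE_udec_log c) satisfiable_log"
  then obtain f where f: "\<And>I. I \<in> TE_udec_log c \<Longrightarrow>
      computes f [code_instance I] (if satisfiable_log I then 1 else 0)"
    unfolding decidable_problem_def by blast
  obtain r where r: "\<And>x. computes r [x] (diagonal_code x)"
    using computable_diagonal_code unfolding computable_def by blast
  obtain ls where ls: "\<forall>c\<ge>64. \<forall>x. instance_of ls x \<in> TE_udec_log c"
    "\<forall>x\<ge>code_list code_layer ls.
      satisfiable_log (instance_of ls x) \<longleftrightarrow> computes (Comp f [r]) [x] 0"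
    using halting_instance by blast
  define x where "x = code_list code_layer ls"
  let ?I = "instance_of ls x"
  have "computes f [diagonal_code x] (if satisfiable_log ?I then 1 else 0)"
    using f[of ?I] ls(1) c code_instance_diagonal[OF x_def] by simp
  then have *: "computes (Comp f [r]) [x] (if satisfiable_log ?I then 1 else 0)"
    using computes_Comp1[OF r] by blast
  have "satisfiable_log ?I \<longleftrightarrow> computes (Comp f [r]) [x] 0"
    using ls(2) by (simp add: x_def)
  \<comment> \<open>If \<open>?I\<close> is satisfiable, the composition yields both 1 and 0; if
    not, it yields 0, which makes \<open>?I\<close> satisfiable.\<close>
  then show False
    using * computes_functional[OF *] by (auto split: if_splits)
qed

end
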